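(* Let $G$ be a finite abelian group of order $v$ and let $\{D_1,\dots,D_m\}$ be a $(v,m,k,\lambda)$-SEDF in $G$ with $m\geq 3$. Let $p>2$ be a prime divisor of $v$. Let $\chi$ be a nonprincipal character of $G$ of order $p^a$ such that $\sum_{i=1}^m\chi(D_i)\neq0$ and $\frac{4\lambda}{b_\chi^2-a_\chi^2}$ is not divisible by $p$. Let $q_1,\dots,q_s$ be the distinct prime divisors of $\frac{4\lambda}{b_\chi^2-a_\chi^2}$, let $f=\gcd(\mathrm{ord}_p(q_1),\dots,\mathrm{ord}_p(q_s))$, and let $K$ be the subfield of $\mathbb{Q}(\zeta_{p^a})$ with $[\mathbb{Q}(\zeta_{p^a}):K]=f$. Then there exists an integer $j$ such that, for all $i$ with $1\leq i\leq m$, $\chi(D_i)\zeta_{p^a}^j\in K$ and $\chi(D_i)\overline{\chi(D_i)}$ equals $\frac{(a_\chi+b_\chi)\lambda}{b_\chi-a_\chi}$ or $\frac{(b_\chi-a_\chi)\lambda}{b_\chi+a_\chi}$.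
   Context: Let $G$ be a finite abelian group of order $v$ with identity $e$. A $(v,m,k,\lambda)$-SEDF in $G$ is a collection $\{D_1,\dots,D_m\}$ of pairwise disjoint $k$-subsets of $G$ such that for each $j$ the multiset $\{xy^{-1}: x\in D_\ell,\ y\in D_j,\ \ell\neq j\}$ contains every non-identity element of $G$ exactly $\lambda$ times and does not contain $e$. Characters are extended linearly to $\mathbb{Z}[G]$; $\zeta_n=e^{2\pi i/n}$; $\mathrm{ord}_p(q)$ is the multiplicative order of $q$ modulo $p$. For such an SEDF with $m\geq3$, $D=\bigcup_i D_i$, and a nonprincipal character $\chi$ with $\chi(D)\neq0$, the number $\sqrt{1+4\lambda/|\chi(D)|^2}$ is rational; $a_\chi,b_\chi$ denote the positive integers with $\gcd(a_\chi,b_\chi)=1$ and $b_\chi/a_\chi=\sqrt{1+4\lambda/|\chi(D)|^2}$. *)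

theory Defs
  imports
    Complex_Main
    "HOL-Library.Multiset"
    "HOL-Library.Disjoint_Sets"
    "HOL-Number_Theory.Number_Theory"
    "HOL-Algebra.Algebra"
    "HOL-Algebra.Algebraic_Closure_Type"
begin

text \<open>
  The external differences are indexed by all triples \<open>(\<ell>, x, y)\<close> with \<open>\<ell> \<noteq> j\<close>, \<open>x \<in> D\<^sub>\<ell>\<close>,
  \<open>y \<in> D\<^sub>j\<close>, so that they are counted with multiplicity.
\<close>

definition ext_differences ::
  "('g, 'b) monoid_scheme \<Rightarrow> nat \<Rightarrow> (nat \<Rightarrow> 'g set) \<Rightarrow> nat \<Rightarrow> 'g multiset" where
  "ext_differences G m D j =
     image_mset (\<lambda>(l, x, y). x \<otimes>\<^bsub>G\<^esub> inv\<^bsub>G\<^esub> y)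
       (mset_set (SIGMA l : {1..m} - {j}. D l \<times> D j))"

text \<open>The blocks are \<open>D 1, \<dots>, D m\<close>; values of \<open>D\<close> outside \<open>{1..m}\<close> are irrelevant.\<close>

definition SEDF ::
  "('g, 'b) monoid_scheme \<Rightarrow> nat \<Rightarrow> nat \<Rightarrow> nat \<Rightarrow> nat \<Rightarrow> (nat \<Rightarrow> 'g set) \<Rightarrow> bool" where
  "SEDF G v m k lam D \<longleftrightarrow>
     comm_group G \<and> finite (carrier G) \<and> Coset.order G = v \<and>
     (\<forall>i\<in>{1..m}. D i \<subseteq> carrier G \<and> card (D i) = k) \<and>
     disjoint_family_on D {1..m} \<and>
     (\<forall>j\<in>{1..m}.
        (\<forall>g\<in>carrier G - {\<one>\<^bsub>G\<^esub>}. count (ext_differences G m D j) g = lam) \<and>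
        \<one>\<^bsub>G\<^esub> \<notin># ext_differences G m D j)"

abbreviation complex_field :: "complex ring" where
  "complex_field \<equiv> ring_of_type_algebra"

definition is_character :: "('g, 'b) monoid_scheme \<Rightarrow> ('g \<Rightarrow> complex) \<Rightarrow> bool" where
  "is_character G \<chi> \<longleftrightarrow> \<chi> \<in> hom G (units_of complex_field)"

definition nonprincipal :: "('g, 'b) monoid_scheme \<Rightarrow> ('g \<Rightarrow> complex) \<Rightarrow> bool" where
  "nonprincipal G \<chi> \<longleftrightarrow> (\<exists>x\<in>carrier G. \<chi> x \<noteq> 1)"

definition character_order :: "('g, 'b) monoid_scheme \<Rightarrow> ('g \<Rightarrow> complex) \<Rightarrow> nat" where
  "character_order G \<chi> = (LEAST n. n > 0 \<and> (\<forall>x\<in>carrier G. \<chi> x ^ n = 1))"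

text \<open>
  The linear extension of \<open>\<chi>\<close> to the group ring, evaluated at a subset
  \<open>S\<close> of the group (identified with the sum of its elements).
\<close>

definition char_sum :: "('g \<Rightarrow> complex) \<Rightarrow> 'g set \<Rightarrow> complex" where
  "char_sum \<chi> S = (\<Sum>x\<in>S. \<chi> x)"

definition zeta :: "nat \<Rightarrow> complex" where
  "zeta n = exp (2 * of_real pi * \<i> / of_nat n)"

definition cyclotomic_field :: "nat \<Rightarrow> complex set" where
  "cyclotomic_field n = generate_field complex_field (\<rat> \<union> {zeta n})"

text \<open>\<open>K\<close> is a subfield of \<open>L \<subseteq> \<complex>\<close> with \<open>[L : K] = n\<close>.\<close>

definition subfield_of_degree :: "complex set \<Rightarrow> complex set \<Rightarrow> nat \<Rightarrow> bool" where
  "subfield_of_degree K L n \<longleftrightarrow>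
     subfield K complex_field \<and> K \<subseteq> L \<and> ring.dimension complex_field n K L"

text \<open>
  The number \<open>4\<lambda> / (b\<^sup>2 - a\<^sup>2)\<close> for the pair \<open>(a, b)\<close> = \<open>(a\<^sub>\<chi>, b\<^sub>\<chi>)\<close>.  Then \<open>b > a\<close>, and the division
  is exact: \<open>\<bar>\<chi>(D)\<bar>\<^sup>2 = 4\<lambda>a\<^sup>2 / (b\<^sup>2 - a\<^sup>2)\<close> is a rational algebraic integer, hence an integer,
  and \<open>a\<^sup>2\<close> is coprime to \<open>b\<^sup>2 - a\<^sup>2\<close>.
\<close>

definition quot_number :: "nat \<Rightarrow> nat \<Rightarrow> nat \<Rightarrow> nat" where
  "quot_number lam a b = (4 * lam) div (b\<^sup>2 - a\<^sup>2)"

end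

theory Submission
  imports Defs
begin

text \<open>
  Write \<open>z = zeta (p\<^sup>r)\<close>, \<open>x\<^sub>j = \<chi>(D\<^sub>j)\<close> and \<open>W = \<Sum>\<^sub>j x\<^sub>j\<close>. The defining property gives
  \<open>(W - x\<^sub>j) \<cdot> cnj x\<^sub>j = -\<lambda>\<close>, so \<open>x\<^sub>j / W\<close> is a real root of a quadratic equation and
  \<open>2 x\<^sub>j = (a \<plusminus> b) Y\<close> for \<open>Y = W / a\<close>. As \<open>a\<close> and \<open>a \<plusminus> b\<close> are coprime, \<open>Y\<close> lies in \<open>\<int>[z]\<close>, and
  \<open>Y \<cdot> cnj Y = N = 4\<lambda> / (b\<^sup>2 - a\<^sup>2)\<close>.

  Let \<open>\<sigma>\<close> fix \<open>K\<close>. Its order divides \<open>f\<close>, so for every prime \<open>q\<close> dividing \<open>N\<close> it is a power of the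
  Frobenius substitution at \<open>q\<close> (the Galois group is cyclic), and it fixes the prime ideals above
  \<open>q\<close>. Hence \<open>N\<close> divides \<open>\<sigma>(Y) \<cdot> cnj Y\<close>, and the quotient \<open>\<sigma>(Y) / Y\<close> is an element of \<open>\<int>[z]\<close> all of
  whose conjugates have modulus 1, that is \<open>\<plusminus> z\<^sup>c\<close>. Reduction modulo the prime above \<open>p\<close> (where
  \<open>z \<equiv> 1\<close>) excludes the minus sign. If \<open>\<sigma>\<close> is not the
  identity, then \<open>\<sigma>(z) = z\<^sup>t\<close> with \<open>t - 1\<close> prime to \<open>p\<close>, because its order divides \<open>p - 1\<close>, so a twist by
  some \<open>z\<^sup>j\<close> makes \<open>Y\<close> invariant under \<open>\<sigma>\<close>; as the automorphisms commute, the same twist works for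
  all of them, which puts \<open>Y z\<^sup>j\<close>, and then every \<open>x\<^sub>i z\<^sup>j\<close>, into \<open>K\<close>.
\<close>

subsection \<open>Integer polynomials evaluated at a complex number\<close>

text \<open>Elements of \<int>[w] are represented by integer polynomials, so that congruences in
  \<int>[X] transfer to \<int>[w] by evaluation.\<close>

definition ev :: "int poly \<Rightarrow> complex \<Rightarrow> complex" where
  "ev P w = poly (map_poly of_int P) w"

lemma ev_0 [simp]: "ev 0 w = 0"
  and ev_1 [simp]: "ev 1 w = 1"
  and ev_const [simp]: "ev [:c:] w = of_int c"
  by (simp_all add: ev_def map_poly_pCons)

lemma ev_pCons [simp]: "ev (pCons c P) w = of_int c + w * ev P w"
  by (simp add: ev_def map_poly_pCons)

lemma ev_add [simp]: "ev (P + Q) w = ev P w + ev Q w"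
proof (induction P arbitrary: Q)
  case (pCons c P)
  obtain d Q' where "Q = pCons d Q'" by (rule pCons_cases)
  then show ?case by (simp add: pCons.IH algebra_simps)
qed simp

lemma ev_smult [simp]: "ev (smult c P) w = of_int c * ev P w"
  by (induction P) (simp_all add: algebra_simps)

lemma ev_minus [simp]: "ev (- P) w = - ev P w"
  using ev_smult[of "-1" P w] by simp

lemma ev_diff [simp]: "ev (P - Q) w = ev P w - ev Q w"
  using ev_add[of P "- Q" w] by simp

lemma ev_mult [simp]: "ev (P * Q) w = ev P w * ev Q w"
  by (induction P) (simp_all add: algebra_simps)

lemma ev_power [simp]: "ev (P ^ k) w = ev P w ^ k"
  by (induction k) simp_all

lemma ev_sum [simp]: "ev (sum f A) w = (\<Sum>x\<in>A. ev (f x) w)"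
  by (induction A rule: infinite_finite_induct) simp_all

lemma ev_monom [simp]: "ev (monom c k) w = of_int c * w ^ k"
  by (induction k) (simp_all add: monom_0 monom_Suc)

lemma ev_pcompose_monom [simp]: "ev (pcompose P (monom 1 t)) w = ev P (w ^ t)"
  by (induction P) (simp_all add: pcompose_pCons)

lemma ev_one_right: "ev P 1 = of_int (poly P 1)"
  by (induction P) simp_all

lemma cnj_ev: "cnj (ev P w) = ev P (cnj w)"
  by (induction P) simp_all

section \<open>Frobenius congruences in \<int>[X]\<close>

lemma freshmans_dream_int_poly:
  fixes P Q :: "int poly"
  assumes "Factorial_Ring.prime q"
  shows "of_nat q dvd (P + Q) ^ q - (P ^ q + Q ^ q)"
proof -
  have q: "q > 0" using assms prime_gt_0_nat by blast
  have "(P + Q) ^ q = (\<Sum>k\<le>q. of_nat (q choose k) * P ^ k * Q ^ (q - k))"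
    by (rule binomial_ring)
  also have "{..q} = insert 0 (insert q {0<..<q})" by auto
  also have "(\<Sum>k\<in>\<dots>. of_nat (q choose k) * P ^ k * Q ^ (q - k))
      = P ^ q + Q ^ q + (\<Sum>k\<in>{0<..<q}. of_nat (q choose k) * P ^ k * Q ^ (q - k))"
    using q by simp
  finally have "(P + Q) ^ q - (P ^ q + Q ^ q)
      = (\<Sum>k\<in>{0<..<q}. of_nat (q choose k) * P ^ k * Q ^ (q - k))"
    by simp
  moreover have "(of_nat q :: int poly) dvd of_nat (q choose k) * P ^ k * Q ^ (q - k)"
    if "k \<in> {0<..<q}" for k
  proof -
    have "q dvd q choose k"
      using that by (intro dvd_choose_prime assms) auto
    then have "(of_nat q :: int poly) dvd of_nat (q choose k)" by (metis dvd_def of_nat_mult)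
    then show ?thesis by (simp add: mult.assoc)
  qed
  ultimately show ?thesis by (metis (no_types, lifting) dvd_sum)
qed

text \<open>Writing the polynomial as \<open>c + x * P\<close>, the freshman's dream separates the
  two terms; Fermat's little theorem handles \<open>c\<close>, the induction hypothesis handles
  \<open>P\<close>.\<close>

lemma frobenius_int_poly:
  fixes P :: "int poly"
  assumes q: "Factorial_Ring.prime q"
  shows "of_nat q dvd P ^ q - pcompose P (monom 1 q)"
proof (induction P)
  case 0
  have "q > 0" using q prime_gt_0_nat by blast
  then show ?case by (simp add: zero_power)
next
  case (pCons c P)
  define x where "x = (monom 1 1 :: int poly)"
  have x: "x ^ q = monom 1 q" by (simp add: x_def monom_power)
  have eq: "pCons c P = [:c:] + x * P"
    by (simp add: x_def monom_Suc monom_0)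
  have "int q dvd c ^ q - c"
  proof -
    have "[c ^ q = c] (mod int q)"
    proof (cases "int q dvd c")
      case True
      moreover have "q > 0" using q prime_gt_0_nat by blast
      ultimately have "int q dvd c ^ q" by (meson dvd_power dvd_trans)
      then show ?thesis using True by (simp add: cong_def mod_eq_0_iff_dvd)
    next
      case False
      define a where "a = nat (c mod int q)"
      have qpos: "q > 0" using q prime_gt_0_nat by blast
      have ca: "[c = int a] (mod int q)"
        using qpos by (simp add: a_def cong_def)
      have "\<not> q dvd a" using False ca
        by (metis cong_dvd_iff of_nat_dvd_iff)
      then have "[a ^ (q - 1) = 1] (mod q)" using q fermat_theorem by blast
      then have "[a ^ (q - 1) * a = 1 * a] (mod q)" by (rule cong_scalar_right)
      then have "[a ^ q = a] (mod q)"
        using qpos by (metis mult_1 power_minus_mult)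
      then have "[int a ^ q = int a] (mod int q)"
        by (metis cong_int_iff of_nat_power)
      then show ?thesis using ca by (meson cong_pow cong_sym cong_trans)
    qed
    then show ?thesis by (simp add: cong_iff_dvd_diff)
  qed
  then obtain u where u: "c ^ q - c = int q * u" by blast
  have 1: "(of_nat q :: int poly) dvd [:c:] ^ q - [:c:]"
  proof
    have "[:c:] ^ q - [:c:] = [:c ^ q - c:]" by (simp add: poly_const_pow)
    then show "[:c:] ^ q - [:c:] = of_nat q * [:u:]" by (simp add: u of_nat_poly)
  qed
  have 2: "of_nat q dvd ([:c:] + x * P) ^ q - ([:c:] ^ q + (x * P) ^ q)"
    by (rule freshmans_dream_int_poly[OF q])
  have 3: "of_nat q dvd x ^ q * (P ^ q - pcompose P (monom 1 q))"
    using pCons.IH by (rule dvd_mult)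
  have "pCons c P ^ q - pcompose (pCons c P) (monom 1 q) =
      (([:c:] + x * P) ^ q - ([:c:] ^ q + (x * P) ^ q)) + ([:c:] ^ q - [:c:])
      + x ^ q * (P ^ q - pcompose P (monom 1 q))"
    by (simp only: eq[symmetric] pcompose_pCons x power_mult_distrib) (simp add: algebra_simps)
  then show ?case using 1 2 3 by (simp only: dvd_add)
qed

lemma frobenius_int_poly_iterated:
  fixes P :: "int poly"
  assumes q: "Factorial_Ring.prime q"
  shows "of_nat q dvd P ^ (q ^ k) - pcompose P (monom 1 (q ^ k))"
proof (induction k)
  case (Suc k)
  define A where "A = P ^ (q ^ k)"
  define B where "B = pcompose P (monom 1 (q ^ k))"
  have "A - B dvd A ^ q - B ^ q"
    by (simp add: power_diff_sumr2)
  then have "of_nat q dvd A ^ q - B ^ q"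
    using Suc unfolding A_def B_def by (rule dvd_trans[rotated])
  moreover have "of_nat q dvd B ^ q - pcompose B (monom 1 q)"
    by (rule frobenius_int_poly[OF q])
  ultimately have "of_nat q dvd (A ^ q - B ^ q) + (B ^ q - pcompose B (monom 1 q))"
    by (rule dvd_add)
  moreover have "pcompose B (monom 1 q) = pcompose P (monom 1 (q ^ Suc k))"
  proof -
    have "pcompose (monom 1 j) (monom 1 q) = (monom 1 (q * j) :: int poly)" for j
      by (induction j) (simp_all add: monom_0 monom_Suc pcompose_pCons mult_monom)
    then show ?thesis by (simp add: B_def flip: pcompose_assoc)
  qed
  moreover have "A ^ q = P ^ (q ^ Suc k)"
    by (simp add: A_def power_mult[symmetric] mult.commute)
  ultimately show ?case by simp
next
  case 0
  have "pcompose P (monom 1 (q ^ 0)) = P"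
    using pcompose_idR[of P] by (simp add: monom_Suc monom_0)
  then show ?case by simp
qed

text \<open>Each further \<open>q\<close>-th power gains one factor \<open>q\<close>: when
  \<open>C\<close> and \<open>E\<close> agree modulo \<open>q\<close>, the cofactor of
  \<open>C - E\<close> in \<open>C ^ q - E ^ q\<close> is a sum of \<open>q\<close> terms, all
  congruent to \<open>E ^ (q - 1)\<close>.\<close>

lemma dvd_power_diff_prime_power:
  fixes A B :: "'a::comm_ring_1"
  assumes "of_nat q dvd A - B"
  shows "of_nat q ^ Suc k dvd A ^ (q ^ k) - B ^ (q ^ k)"
proof (induction k)
  case (Suc k)
  define C where "C = A ^ (q ^ k)"
  define E where "E = B ^ (q ^ k)"
  have CE: "of_nat q ^ Suc k dvd C - E" using Suc by (simp add: C_def E_def)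
  have qCE: "of_nat q dvd C - E" using CE by (metis dvd_mult_left power_Suc)
  have "C ^ q - E ^ q = (C - E) * (\<Sum>i<q. C ^ i * E ^ (q - Suc i))"
    by (simp add: power_diff_sumr2 mult.commute)
  moreover have "of_nat q dvd (\<Sum>i<q. C ^ i * E ^ (q - Suc i))"
  proof -
    have "of_nat q dvd (\<Sum>i<q. C ^ i * E ^ (q - Suc i)) - (\<Sum>i<q. E ^ (q - 1))"
      unfolding sum_subtractf[symmetric]
    proof (rule dvd_sum)
      fix i assume "i \<in> {..<q}"
      then have "E ^ (q - 1) = E ^ i * E ^ (q - Suc i)" by (simp flip: power_add)
      then have "C ^ i * E ^ (q - Suc i) - E ^ (q - 1) = (C ^ i - E ^ i) * E ^ (q - Suc i)"
        by (simp add: algebra_simps)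
      moreover have "C - E dvd C ^ i - E ^ i"
        by (simp add: power_diff_sumr2)
      ultimately show "of_nat q dvd C ^ i * E ^ (q - Suc i) - E ^ (q - 1)"
        using qCE by (metis dvd_mult2 dvd_trans)
    qed
    moreover have "of_nat q dvd (\<Sum>i<q. E ^ (q - 1))" by simp
    ultimately show ?thesis by (metis dvd_add diff_add_cancel)
  qed
  ultimately have "of_nat q ^ Suc k * of_nat q dvd C ^ q - E ^ q"
    using CE by (simp only: mult_dvd_mono)
  then show ?case by (simp add: C_def E_def power_mult[symmetric] mult.commute)
qed (use assms in simp)

subsection \<open>Vanishing of integer polynomials at roots of unity\<close>

lemma zeta_eq_cis: "zeta k = cis (2 * pi / real k)"
  by (simp add: zeta_def cis_conv_exp mult_ac)

lemma zeta_power_eq: "zeta k ^ i = cis (2 * pi * real i / real k)"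
  unfolding zeta_eq_cis DeMoivre by (simp add: mult_ac)

text \<open>A nonzero kernel element of least degree, made primitive, divides every kernel element
  by pseudo-division and Gauss's lemma. It divides the monic polynomial \<open>U\<close>, so its
  leading coefficient is a unit.\<close>

lemma exists_monic_generator_of_evaluation_kernel:
  assumes "k > 0" and "w ^ k = 1"
  shows "\<exists>M. lead_coeff M = 1 \<and> (\<forall>P. ev P w = 0 \<longleftrightarrow> M dvd P)"
proof -
  define A where "A = {P. P \<noteq> 0 \<and> ev P w = 0}"
  define U where "U = (monom 1 k - 1 :: int poly)"
  have U: "lead_coeff U = 1"
  proof -
    have "degree (- 1 :: int poly) < degree (monom 1 k :: int poly)"
      using assms(1) by (simp add: degree_monom_eq)
    then have "lead_coeff (- 1 + monom 1 k :: int poly) = lead_coeff (monom 1 k :: int poly)"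
      by (rule lead_coeff_add_le)
    moreover have "U = - 1 + monom 1 k" by (simp add: U_def)
    ultimately show ?thesis by (simp only: lead_coeff_monom)
  qed
  have "U \<noteq> 0" using U by auto
  then have "U \<in> A" using assms(2) by (simp add: A_def U_def)
  then obtain M0 where M0: "M0 \<in> A" and min: "\<And>P. P \<in> A \<Longrightarrow> degree M0 \<le> degree P"
    using ex_has_least_nat[of "\<lambda>P. P \<in> A" U degree] by blast
  define M1 where "M1 = primitive_part M0"
  have M1: "M1 \<noteq> 0" "content M1 = 1" "degree M1 = degree M0"
    using M0 by (simp_all add: A_def M1_def)
  have M1_0: "ev M1 w = 0"
  proof -
    have "ev M0 w = of_int (content M0) * ev M1 w"
      unfolding M1_def by (metis content_times_primitive_part ev_smult)
    then show ?thesis using M0 by (auto simp: A_def)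
  qed
  have dvd: "M1 dvd P" if P: "ev P w = 0" for P
  proof -
    define S where "S = pseudo_mod P M1"
    obtain c Q where c: "c \<noteq> 0" "smult c P = M1 * Q + S"
      using pseudo_mod(1)[OF M1(1), of P] by (auto simp: S_def)
    have "ev (smult c P) w = ev (M1 * Q + S) w" by (simp only: c)
    then have "ev S w = 0" using P M1_0 by simp
    moreover have "S = 0 \<or> degree S < degree M1"
      using pseudo_mod(2)[OF M1(1), of P] by (auto simp: S_def)
    moreover have "degree M1 \<le> degree S" if "S \<noteq> 0" "ev S w = 0"
      using min[of S] M1(3) that by (simp add: A_def)
    ultimately have "S = 0" by (metis not_less)
    then have eq: "smult c P = M1 * Q" using c by simp
    \<comment> \<open>Gauss's lemma: \<open>M1\<close> is primitive, so the factor \<open>c\<close>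
      introduced by pseudo-division divides the content of \<open>Q\<close> and cancels.\<close>
    then have "content (smult c P) = content Q"
      using M1(2) by (simp add: content_mult)
    then have "c dvd content Q" by (metis content_smult dvd_triv_left dvd_normalize_iff normalize_dvd_iff dvd_mult2 dvd_refl)
    then have "[:c:] dvd Q" by (simp add: const_poly_dvd_iff_dvd_content)
    then obtain Q' where "Q = [:c:] * Q'" by blast
    then have "smult c P = smult c (M1 * Q')" using eq by simp
    then have "P = M1 * Q'" using c(1) by (metis smult_eq_iff smult_cancel)
    then show ?thesis by simp
  qed
  have "M1 dvd U" using \<open>U \<in> A\<close> dvd by (simp add: A_def)
  then obtain H where "U = M1 * H" by blast
  then have "lead_coeff M1 * lead_coeff H = 1" using U by (simp add: lead_coeff_mult)
  then have lc: "lead_coeff M1 = 1 \<or> lead_coeff M1 = -1" using zmult_eq_1_iff by blast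
  define M where "M = smult (lead_coeff M1) M1"
  have "lead_coeff M = 1" using lc by (auto simp: M_def)
  moreover have "ev P w = 0 \<longleftrightarrow> M dvd P" for P
  proof
    assume "ev P w = 0"
    then show "M dvd P" using dvd[of P] lc by (auto simp: M_def)
  next
    assume "M dvd P"
    then have "M1 dvd P" using lc by (auto simp: M_def)
    then show "ev P w = 0" using M1_0 by auto
  qed
  ultimately show ?thesis by blast
qed

text \<open>\<int>[w] meets \<rat> only in \<int>: after reduction modulo the monic generator
  \<open>M\<close>, \<open>smult d S - [:c:]\<close> lies in the kernel but has degree below that of
  \<open>M\<close>. Hence it is zero, and the constant coefficients agree.\<close>

lemma ev_root_of_unity_rat_is_int:
  assumes k: "k > 0" "w ^ k = 1" and d: "d \<noteq> 0" and eq: "of_int d * ev P w = of_int c"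
  shows "d dvd c"
proof -
  obtain M where M: "lead_coeff M = 1" "\<And>P. ev P w = 0 \<longleftrightarrow> M dvd P"
    using exists_monic_generator_of_evaluation_kernel[OF k] by blast
  then have M0: "M \<noteq> 0" by auto
  have degM: "degree M > 0"
  proof (rule ccontr)
    assume "\<not> degree M > 0"
    then obtain c where "M = [:c:]" by (meson degree_eq_zeroE gr0I)
    then have "M = 1" using M(1) by simp
    then show False using M(2)[of 1] by simp
  qed
  obtain Q S where QS: "pseudo_divmod P M = (Q, S)" by force
  have PQS: "P = M * Q + S" and S: "S = 0 \<or> degree S < degree M"
    using pseudo_divmod[OF M0 QS] M(1) by simp_all
  have "ev M w = 0" using M(2) by simp
  then have "ev P w = ev S w" using PQS by simp
  then have "ev (smult d S - [:c:]) w = 0" using eq by simp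
  then have dv: "M dvd smult d S - [:c:]" using M(2) by blast
  have "smult d S - [:c:] = 0"
  proof (rule ccontr)
    assume "smult d S - [:c:] \<noteq> 0"
    then have "degree M \<le> degree (smult d S - [:c:])" using dv by (simp add: dvd_imp_degree_le)
    also have "\<dots> \<le> max (degree (smult d S)) (degree [:c:])" by (rule degree_diff_le_max)
    also have "\<dots> < degree M" using S d degM by auto
    finally show False by simp
  qed
  then have "coeff (smult d S) 0 = coeff [:c:] 0" by simp
  then show ?thesis by (metis coeff_pCons_0 coeff_smult dvd_triv_left)
qed

section \<open>Roots of unity of odd prime power order\<close>

locale prime_power_cyclotomic =
  fixes p r :: nat
  assumes prime_p: "Factorial_Ring.prime p" and p_gt_2: "p > 2" and r_pos: "r > 0"
begin

definition n :: nat where "n = p ^ r"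
definition z :: complex where "z = zeta n"

lemma p_pos: "p > 0" and n_pos: "n > 0" and p_dvd_n: "p dvd n"
  using p_gt_2 r_pos by (simp_all add: n_def)

lemma coprime_n_iff: "coprime t n \<longleftrightarrow> \<not> p dvd t"
proof -
  have "coprime t n \<longleftrightarrow> coprime t p"
    using r_pos by (simp add: n_def)
  also have "\<dots> \<longleftrightarrow> \<not> p dvd t"
    using prime_p by (metis coprime_commute dvd_refl not_coprimeI not_prime_unit prime_imp_coprime)
  finally show ?thesis .
qed

lemma z_power_n [simp]: "z ^ n = 1"
  using n_pos by (simp add: z_def zeta_power_eq)

lemma z_nonzero [simp]: "z \<noteq> 0"
  using z_power_n n_pos by (metis power_eq_0_iff zero_neq_one zero_power)

lemma norm_z [simp]: "cmod z = 1"
  by (simp add: z_def zeta_eq_cis)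

lemma roots_of_unity_bij: "bij_betw (\<lambda>k. z ^ k) {..<n} {w. w ^ n = 1}"
  using bij_betw_roots_unity[OF n_pos] by (simp add: z_def zeta_power_eq)

lemma z_power_mod: "z ^ (i mod n) = z ^ i"
  by (metis mult_1 power_add power_mult power_one z_power_n div_mult_mod_eq mult.commute)

lemma z_power_eq_iff: "z ^ i = z ^ j \<longleftrightarrow> [i = j] (mod n)"
proof
  assume "z ^ i = z ^ j"
  then have "z ^ (i mod n) = z ^ (j mod n)" by (simp add: z_power_mod)
  moreover have "inj_on (\<lambda>k. z ^ k) {..<n}" using roots_of_unity_bij bij_betw_def by blast
  ultimately have "i mod n = j mod n" using n_pos by (auto dest: inj_onD)
  then show "[i = j] (mod n)" by (simp add: cong_def)
qed (metis cong_def z_power_mod)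

lemma z_power_eq_1_iff: "z ^ i = 1 \<longleftrightarrow> n dvd i"
  using z_power_eq_iff[of i 0] by (simp add: cong_0_iff)

lemma root_of_unity_is_z_power: "w ^ n = 1 \<Longrightarrow> \<exists>i. w = z ^ i"
  using roots_of_unity_bij by (auto simp: bij_betw_def)

lemma inverse_z: "inverse z = z ^ (n - 1)"
  using n_pos by (metis z_power_n inverse_unique mult.commute power_minus_mult)

lemma cnj_z: "cnj z = z ^ (n - 1)"
proof -
  have "z * cnj z = 1" using complex_norm_square[of z] by simp
  then show ?thesis by (metis inverse_unique inverse_z)
qed

text \<open>Reduction modulo the prime above \<open>p\<close>, where \<open>z\<close> becomes 1,
  without ideals: \<open>P ^ n\<close> and \<open>P(X ^ n)\<close> agree modulo \<open>p\<close>,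
  and the latter takes the value \<open>P(1)\<close> at \<open>z\<close>. So \<open>P(1)\<close> is
  an integer in \<open>p\<close> \<int>[z].\<close>

lemma prime_dvd_poly_1:
  assumes "ev P z = 0"
  shows "int p dvd poly P 1"
proof -
  have "of_nat p dvd P ^ n - pcompose P (monom 1 n)"
    unfolding n_def by (rule frobenius_int_poly_iterated[OF prime_p])
  then obtain U where U: "P ^ n - pcompose P (monom 1 n) = of_nat p * U" by blast
  have "ev (P ^ n - pcompose P (monom 1 n)) z = - of_int (poly P 1)"
    using assms n_pos by (simp add: ev_one_right zero_power)
  moreover have "ev (of_nat p * U) z = of_int (int p) * ev U z"
    by (simp add: of_nat_poly)
  ultimately have "of_int (int p) * ev U z = of_int (- poly P 1)" using U by simp
  then have "int p dvd - poly P 1"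
    using ev_root_of_unity_rat_is_int[OF n_pos z_power_n] p_pos by (metis of_nat_0_eq_iff less_irrefl)
  then show ?thesis by simp
qed

text \<open>An Eisenstein-like argument at 1: in \<open>\<Phi> = M * H\<close> the value
  \<open>p\<close> of \<open>\<Phi>\<close> at 1 is already used up by \<open>M\<close>, so
  \<open>p\<close> does not divide \<open>H(1)\<close> and \<open>H\<close> cannot vanish at
  \<open>z ^ t\<close>. The root \<open>z ^ t\<close> of \<open>\<Phi>\<close> must therefore be a
  root of \<open>M\<close>.\<close>

lemma ev_galois:
  assumes P: "ev P z = 0" and t: "\<not> p dvd t"
  shows "ev P (z ^ t) = 0"
proof -
  obtain M where M: "\<And>P. ev P z = 0 \<longleftrightarrow> M dvd P"
    using exists_monic_generator_of_evaluation_kernel[OF n_pos z_power_n] by blast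
  \<comment> \<open>The \<open>n\<close>-th cyclotomic polynomial.\<close>
  define \<Phi> where "\<Phi> = (\<Sum>i<p. monom 1 (p ^ (r - 1) * i) :: int poly)"
  have \<Phi>: "ev \<Phi> (z ^ s) = 0" if s: "\<not> p dvd s" for s
  proof -
    define w where "w = z ^ (s * p ^ (r - 1))"
    have eq: "n = p ^ (r - 1) * p" using r_pos by (simp add: n_def power_eq_if)
    have "w ^ p = 1"
      unfolding w_def power_mult[symmetric] z_power_eq_1_iff by (simp add: eq mult.assoc)
    moreover have "w \<noteq> 1"
      using s p_pos by (simp add: w_def z_power_eq_1_iff eq mult.commute)
    moreover have "ev \<Phi> (z ^ s) = (\<Sum>i<p. w ^ i)"
      by (simp add: \<Phi>_def w_def power_mult)
    ultimately show ?thesis by (simp add: geometric_sum)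
  qed
  have "ev \<Phi> z = 0" using \<Phi>[of 1] p_gt_2 by simp
  then have "M dvd \<Phi>" using M[of \<Phi>] by simp
  then obtain H where H: "\<Phi> = M * H" by blast
  have "poly \<Phi> 1 = int p" by (simp add: \<Phi>_def poly_sum poly_monom)
  then have pMH: "poly M 1 * poly H 1 = int p" using H by simp
  moreover have "int p dvd poly M 1" using M[of M] by (intro prime_dvd_poly_1) simp
  moreover have "\<not> int p dvd poly H 1" if "int p dvd poly M 1"
  proof
    assume "int p dvd poly H 1"
    with that have "int p * int p dvd poly M 1 * poly H 1" by (rule mult_dvd_mono)
    then have "int p * int p dvd int p * 1" by (simp only: pMH mult.right_neutral)
    then have "int p dvd 1" using p_pos by (subst (asm) dvd_mult_cancel_left) simp
    then show False using p_gt_2 by (simp add: zdvd1_eq)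
  qed
  ultimately have "\<not> int p dvd poly H 1" by blast
  moreover have "poly (pcompose H (monom 1 t)) 1 = poly H 1"
    by (simp add: poly_pcompose poly_monom)
  ultimately have "ev (pcompose H (monom 1 t)) z \<noteq> 0" using prime_dvd_poly_1 by metis
  then have "ev M (z ^ t) = 0" using \<Phi>[OF t] H by simp
  then show ?thesis using P M by auto
qed

end

subsection \<open>Cyclotomic integers and their automorphisms\<close>

context prime_power_cyclotomic
begin

definition cyc_int :: "complex set" where
  "cyc_int = range (\<lambda>P. ev P z)"

text \<open>The field \<rat>(z), written with integer denominators so that computations reduce to
  integer polynomials. Closure under inverses is the content of
  \<open>inverse_in_cyc_rat\<close>.\<close>

definition cyc_rat :: "complex set" where
  "cyc_rat = {x. \<exists>d::int. d \<noteq> 0 \<and> of_int d * x \<in> cyc_int}"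

lemma cyc_intI: "x = ev P z \<Longrightarrow> x \<in> cyc_int"
  by (simp add: cyc_int_def)

lemma cyc_intE:
  assumes "x \<in> cyc_int"
  obtains P where "x = ev P z"
  using assms by (auto simp: cyc_int_def)

lemma cyc_int_of_int [simp]: "of_int c \<in> cyc_int"
  by (rule cyc_intI[of _ "[:c:]"]) simp

lemma cyc_int_of_nat [simp]: "of_nat c \<in> cyc_int"
  using cyc_int_of_int[of "int c"] by simp

lemma cyc_int_0 [simp]: "0 \<in> cyc_int" and cyc_int_1 [simp]: "1 \<in> cyc_int"
  using cyc_int_of_int[of 0] cyc_int_of_int[of 1] by simp_all

lemma cyc_int_add [simp]: "x \<in> cyc_int \<Longrightarrow> y \<in> cyc_int \<Longrightarrow> x + y \<in> cyc_int"
  by (auto simp: cyc_int_def simp flip: ev_add)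

lemma cyc_int_mult [simp]: "x \<in> cyc_int \<Longrightarrow> y \<in> cyc_int \<Longrightarrow> x * y \<in> cyc_int"
  by (auto simp: cyc_int_def simp flip: ev_mult)

lemma cyc_int_minus [simp]: "x \<in> cyc_int \<Longrightarrow> - x \<in> cyc_int"
  by (auto simp: cyc_int_def simp flip: ev_minus)

lemma cyc_int_diff [simp]: "x \<in> cyc_int \<Longrightarrow> y \<in> cyc_int \<Longrightarrow> x - y \<in> cyc_int"
  by (auto simp: cyc_int_def simp flip: ev_diff)

lemma cyc_int_power [simp]: "x \<in> cyc_int \<Longrightarrow> x ^ k \<in> cyc_int"
  by (induction k) simp_all

lemma cyc_int_sum: "(\<And>i. i \<in> A \<Longrightarrow> f i \<in> cyc_int) \<Longrightarrow> sum f A \<in> cyc_int"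
  by (induction A rule: infinite_finite_induct) simp_all

lemma z_in_cyc_int [simp]: "z \<in> cyc_int"
  by (rule cyc_intI[of _ "monom 1 1"]) simp

lemma cyc_int_subset_cyc_rat: "x \<in> cyc_int \<Longrightarrow> x \<in> cyc_rat"
  unfolding cyc_rat_def by (auto intro!: exI[of _ 1])

lemma cyc_ratE:
  assumes "x \<in> cyc_rat"
  obtains d P where "d \<noteq> 0" "of_int d * x = ev P z"
  using assms by (auto simp: cyc_rat_def cyc_int_def)

lemma cyc_ratI: "d \<noteq> 0 \<Longrightarrow> of_int d * x = ev P z \<Longrightarrow> x \<in> cyc_rat"
  by (auto simp: cyc_rat_def cyc_int_def)

lemma cyc_int_rat_is_int:
  assumes "x \<in> cyc_int" "d \<noteq> 0" "of_int d * x = of_int c"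
  shows "d dvd c"
  using assms ev_root_of_unity_rat_is_int[OF n_pos z_power_n] by (auto elim: cyc_intE)

text \<open>
  The automorphism \<open>z \<mapsto> z\<^sup>t\<close> of \<open>\<rat>(z)\<close>. The value does not depend on the representation chosen if
  \<open>t\<close> is prime to \<open>p\<close>; it is meaningless for other \<open>t\<close> and outside \<open>cyc_rat\<close>.
\<close>

definition galois :: "nat \<Rightarrow> complex \<Rightarrow> complex" where
  "galois t x = (let (d, P) = (SOME (d, P). d \<noteq> 0 \<and> of_int d * x = ev P z)
                 in ev P (z ^ t) / of_int d)"

text \<open>Cross-multiplying two representations of \<open>x\<close> gives a polynomial that
  vanishes at \<open>z\<close>, hence at \<open>z ^ t\<close> by \<open>ev_galois\<close>.\<close>

lemma galois_eq:
  assumes t: "\<not> p dvd t" and d: "d \<noteq> 0" and x: "of_int d * x = ev P z"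
  shows "galois t x = ev P (z ^ t) / of_int d"
proof -
  obtain e Q where eQ: "(SOME (d, P). d \<noteq> 0 \<and> of_int d * x = ev P z) = (e, Q)" by force
  have "(case (SOME (d, P). d \<noteq> 0 \<and> of_int d * x = ev P z) of
      (d, P) \<Rightarrow> d \<noteq> 0 \<and> of_int d * x = ev P z)"
    by (rule someI[of _ "(d, P)"]) (use d x in simp)
  then have e: "e \<noteq> 0" "of_int e * x = ev Q z" by (simp_all add: eQ)
  have "ev (smult e P - smult d Q) z = of_int e * (of_int d * x) - of_int d * (of_int e * x)"
    by (simp add: x e)
  then have "ev (smult e P - smult d Q) z = 0" by simp
  then have "ev (smult e P - smult d Q) (z ^ t) = 0" using t by (rule ev_galois)
  then have "of_int e * ev P (z ^ t) = of_int d * ev Q (z ^ t)" by simp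
  then have "ev P (z ^ t) / of_int d = ev Q (z ^ t) / of_int e"
    using d e by (simp add: field_simps)
  then show ?thesis by (simp add: galois_def eQ)
qed

lemma galois_ev: "\<not> p dvd t \<Longrightarrow> galois t (ev P z) = ev P (z ^ t)"
  using galois_eq[of t 1 "ev P z" P] by simp

lemma galois_of_int [simp]: "\<not> p dvd t \<Longrightarrow> galois t (of_int c) = of_int c"
  using galois_ev[of t "[:c:]"] by simp

lemma galois_of_nat [simp]: "\<not> p dvd t \<Longrightarrow> galois t (of_nat c) = of_nat c"
  using galois_of_int[of t "int c"] by simp

lemma galois_0 [simp]: "\<not> p dvd t \<Longrightarrow> galois t 0 = 0"
  and galois_1 [simp]: "\<not> p dvd t \<Longrightarrow> galois t 1 = 1"
  using galois_of_int[of t 0] galois_of_int[of t 1] by simp_all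

lemma galois_z_power: "\<not> p dvd t \<Longrightarrow> galois t (z ^ i) = z ^ (t * i)"
  using galois_ev[of t "monom 1 i"] by (simp add: power_mult)

lemma cyc_rat_add [simp]: "x \<in> cyc_rat \<Longrightarrow> y \<in> cyc_rat \<Longrightarrow> x + y \<in> cyc_rat"
  and galois_add: "\<not> p dvd t \<Longrightarrow> x \<in> cyc_rat \<Longrightarrow> y \<in> cyc_rat \<Longrightarrow>
    galois t (x + y) = galois t x + galois t y"
proof -
  assume x: "x \<in> cyc_rat" and y: "y \<in> cyc_rat"
  from x obtain d P where d: "d \<noteq> 0" "of_int d * x = ev P z" by (rule cyc_ratE)
  from y obtain e Q where e: "e \<noteq> 0" "of_int e * y = ev Q z" by (rule cyc_ratE)
  have eq: "of_int (d * e) * (x + y) = ev (smult e P + smult d Q) z"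
    by (simp add: d(2)[symmetric] e(2)[symmetric] algebra_simps)
  have de: "d * e \<noteq> 0" using d e by simp
  show "x + y \<in> cyc_rat" by (rule cyc_ratI[OF de eq])
  assume t: "\<not> p dvd t"
  show "galois t (x + y) = galois t x + galois t y"
    unfolding galois_eq[OF t de eq] galois_eq[OF t d] galois_eq[OF t e]
    using d(1) e(1) by (simp add: add_divide_distrib)
qed

lemma cyc_rat_mult [simp]: "x \<in> cyc_rat \<Longrightarrow> y \<in> cyc_rat \<Longrightarrow> x * y \<in> cyc_rat"
  and galois_mult: "\<not> p dvd t \<Longrightarrow> x \<in> cyc_rat \<Longrightarrow> y \<in> cyc_rat \<Longrightarrow>
    galois t (x * y) = galois t x * galois t y"
proof -
  assume x: "x \<in> cyc_rat" and y: "y \<in> cyc_rat"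
  from x obtain d P where d: "d \<noteq> 0" "of_int d * x = ev P z" by (rule cyc_ratE)
  from y obtain e Q where e: "e \<noteq> 0" "of_int e * y = ev Q z" by (rule cyc_ratE)
  have eq: "of_int (d * e) * (x * y) = ev (P * Q) z"
    by (simp add: d(2)[symmetric] e(2)[symmetric] algebra_simps)
  have de: "d * e \<noteq> 0" using d e by simp
  show "x * y \<in> cyc_rat" by (rule cyc_ratI[OF de eq])
  assume t: "\<not> p dvd t"
  show "galois t (x * y) = galois t x * galois t y"
    unfolding galois_eq[OF t de eq] galois_eq[OF t d] galois_eq[OF t e] by simp
qed

lemma cyc_rat_of_int [simp]: "of_int c \<in> cyc_rat"
  and cyc_rat_of_nat [simp]: "of_nat c' \<in> cyc_rat"
  and cyc_rat_0 [simp]: "0 \<in> cyc_rat"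
  and cyc_rat_1 [simp]: "1 \<in> cyc_rat"
  and cyc_rat_z [simp]: "z \<in> cyc_rat"
  by (simp_all add: cyc_int_subset_cyc_rat)

lemma cyc_rat_power [simp]: "x \<in> cyc_rat \<Longrightarrow> x ^ k \<in> cyc_rat"
  by (induction k) simp_all

lemma cyc_rat_minus [simp]: "x \<in> cyc_rat \<Longrightarrow> - x \<in> cyc_rat"
  using cyc_rat_mult[of "of_int (-1)" x] cyc_rat_of_int[of "-1"] by simp

lemma cyc_rat_diff [simp]: "x \<in> cyc_rat \<Longrightarrow> y \<in> cyc_rat \<Longrightarrow> x - y \<in> cyc_rat"
  using cyc_rat_add[of x "- y"] by simp

lemma galois_minus: "\<not> p dvd t \<Longrightarrow> x \<in> cyc_rat \<Longrightarrow> galois t (- x) = - galois t x"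
  using galois_mult[of t "of_int (-1)" x] galois_of_int[of t "-1"] by simp

lemma galois_diff:
  "\<not> p dvd t \<Longrightarrow> x \<in> cyc_rat \<Longrightarrow> y \<in> cyc_rat \<Longrightarrow> galois t (x - y) = galois t x - galois t y"
  using galois_add[of t x "- y"] by (simp add: galois_minus)

lemma galois_power: "\<not> p dvd t \<Longrightarrow> x \<in> cyc_rat \<Longrightarrow> galois t (x ^ k) = galois t x ^ k"
  by (induction k) (simp_all add: galois_mult)

lemma galois_in_cyc_int [simp]: "\<not> p dvd t \<Longrightarrow> x \<in> cyc_int \<Longrightarrow> galois t x \<in> cyc_int"
  by (auto elim!: cyc_intE simp: galois_ev simp flip: ev_pcompose_monom intro: cyc_intI)

lemma cyc_rat_galois:
  assumes t: "\<not> p dvd t" and x: "x \<in> cyc_rat"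
  shows "galois t x \<in> cyc_rat"
    and "\<not> p dvd s \<Longrightarrow> galois s (galois t x) = galois (s * t) x"
proof -
  obtain d P where d: "d \<noteq> 0" "of_int d * x = ev P z" using x by (rule cyc_ratE)
  have eq: "of_int d * galois t x = ev (pcompose P (monom 1 t)) z"
    using d by (simp add: galois_eq[OF t d])
  show "galois t x \<in> cyc_rat" by (rule cyc_ratI[OF d(1) eq])
  assume s: "\<not> p dvd s"
  then have st: "\<not> p dvd s * t" using t prime_p by (simp add: prime_dvd_mult_iff)
  show "galois s (galois t x) = galois (s * t) x"
    unfolding galois_eq[OF s d(1) eq] galois_eq[OF st d] by (simp add: power_mult)
qed

lemma p_dvd_cong: "[s = t] (mod n) \<Longrightarrow> p dvd s \<longleftrightarrow> p dvd t"
  using p_dvd_n cong_dvd_iff cong_dvd_modulus_nat by blast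

lemma galois_cong:
  assumes "[s = t] (mod n)"
  shows "galois s x = galois t x"
  using assms by (simp add: galois_def flip: z_power_eq_iff)

lemma galois_one: "x \<in> cyc_rat \<Longrightarrow> galois 1 x = x"
proof -
  assume "x \<in> cyc_rat"
  then obtain d P where d: "d \<noteq> 0" "of_int d * x = ev P z" by (rule cyc_ratE)
  have "\<not> p dvd 1" using p_gt_2 by simp
  from galois_eq[OF this d] show ?thesis using d(1) by (simp flip: d(2))
qed

lemma not_p_dvd_n_minus_1: "\<not> p dvd n - 1"
proof
  assume "p dvd n - 1"
  then have "p dvd 1" using p_dvd_n n_pos by (metis One_nat_def Suc_leI diff_diff_cancel dvd_diff_nat)
  then show False using p_gt_2 by simp
qed

text \<open>Conjugation inverts \<open>z\<close> and fixes integers, so it is one of the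
  automorphisms and commutes with all of them.\<close>

lemma cnj_eq_galois:
  assumes "x \<in> cyc_rat"
  shows "cnj x = galois (n - 1) x"
proof -
  obtain d P where d: "d \<noteq> 0" "of_int d * x = ev P z" using assms by (rule cyc_ratE)
  have "cnj (of_int d * x) = ev P (z ^ (n - 1))" unfolding d(2) cnj_ev cnj_z ..
  then show ?thesis unfolding galois_eq[OF not_p_dvd_n_minus_1 d] using d(1)
    by (simp add: field_simps)
qed

lemma cnj_galois: "\<not> p dvd t \<Longrightarrow> x \<in> cyc_rat \<Longrightarrow> cnj (galois t x) = galois t (cnj x)"
  by (simp add: cnj_eq_galois cyc_rat_galois not_p_dvd_n_minus_1[simplified] mult.commute)

lemma cnj_in_cyc_int [simp]: "x \<in> cyc_int \<Longrightarrow> cnj x \<in> cyc_int"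
  by (simp add: cnj_eq_galois cyc_int_subset_cyc_rat not_p_dvd_n_minus_1[simplified])

lemma cnj_in_cyc_rat [simp]: "x \<in> cyc_rat \<Longrightarrow> cnj x \<in> cyc_rat"
  by (simp add: cnj_eq_galois cyc_rat_galois not_p_dvd_n_minus_1[simplified])

section \<open>Divisibility by integers in \<int>[z] and the Frobenius substitution\<close>

definition cyc_dvd :: "int \<Rightarrow> complex \<Rightarrow> bool" where
  "cyc_dvd d x \<longleftrightarrow> (\<exists>u\<in>cyc_int. x = of_int d * u)"

lemma cyc_dvd_add: "cyc_dvd d x \<Longrightarrow> cyc_dvd d y \<Longrightarrow> cyc_dvd d (x + y)"
  unfolding cyc_dvd_def by (metis cyc_int_add distrib_left)

lemma cyc_dvd_mult_left: "cyc_dvd d x \<Longrightarrow> y \<in> cyc_int \<Longrightarrow> cyc_dvd d (y * x)"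
  unfolding cyc_dvd_def by (metis cyc_int_mult mult.left_commute)

lemma cyc_dvd_mult_right: "cyc_dvd d x \<Longrightarrow> y \<in> cyc_int \<Longrightarrow> cyc_dvd d (x * y)"
  using cyc_dvd_mult_left by (simp add: mult.commute)

lemma cyc_dvd_ev: "of_int d dvd P \<Longrightarrow> cyc_dvd d (ev P z)"
  unfolding cyc_dvd_def dvd_def by (auto simp: of_int_poly intro: cyc_intI)

lemma cyc_dvd_of_dvd: "c dvd d \<Longrightarrow> cyc_dvd d x \<Longrightarrow> cyc_dvd c x"
  unfolding cyc_dvd_def dvd_def
  by (metis cyc_int_mult cyc_int_of_int mult.assoc of_int_mult)

lemma cyc_dvd_coprime_mult:
  assumes "coprime c d" "cyc_dvd c x" "cyc_dvd d x"
  shows "cyc_dvd (c * d) x"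
proof -
  obtain a b where ab: "a * c + b * d = 1"
    using assms(1) by (metis bezout_int coprime_iff_gcd_eq_1)
  obtain u v where u: "u \<in> cyc_int" "x = of_int c * u" and v: "v \<in> cyc_int" "x = of_int d * v"
    using assms(2,3) unfolding cyc_dvd_def by blast
  have "x = of_int (a * c + b * d) * x" by (simp add: ab)
  also have "\<dots> = of_int a * of_int c * x + of_int b * of_int d * x"
    by (simp add: algebra_simps)
  also have "\<dots> = of_int a * of_int c * (of_int d * v) + of_int b * of_int d * (of_int c * u)"
    by (simp flip: u(2) v(2))
  also have "\<dots> = of_int (c * d) * (of_int a * v + of_int b * u)"
    by (simp add: algebra_simps)
  finally have "x = of_int (c * d) * (of_int a * v + of_int b * u)" .
  then show ?thesis using u(1) v(1) unfolding cyc_dvd_def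
    by (intro bexI[of _ "of_int a * v + of_int b * u"]) simp_all
qed

text \<open>Modulo \<open>q\<close>, the automorphism \<open>z \<mapsto> z ^ (q ^ e)\<close> is
  raising to the power \<open>q ^ e\<close>; taking \<open>q ^ k\<close>-th powers sharpens the
  congruence to the modulus \<open>q ^ Suc k\<close>.\<close>

lemma galois_frobenius_cong:
  assumes q: "Factorial_Ring.prime q" "q \<noteq> p" and x: "x \<in> cyc_int"
  shows "cyc_dvd (int q ^ Suc k) (x ^ (q ^ e * q ^ k) - galois (q ^ e) x ^ (q ^ k))"
proof -
  obtain P where P: "x = ev P z" using x by (rule cyc_intE)
  have "\<not> p dvd q ^ e" using q prime_p by (metis prime_dvd_power primes_dvd_imp_eq)
  then have "galois (q ^ e) x = ev (pcompose P (monom 1 (q ^ e))) z"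
    by (simp add: P galois_ev)
  then have "x ^ (q ^ e * q ^ k) - galois (q ^ e) x ^ (q ^ k)
      = ev ((P ^ (q ^ e)) ^ (q ^ k) - pcompose P (monom 1 (q ^ e)) ^ (q ^ k)) z"
    by (simp add: P power_mult)
  moreover have "(of_nat q :: int poly) ^ Suc k dvd
      (P ^ (q ^ e)) ^ (q ^ k) - pcompose P (monom 1 (q ^ e)) ^ (q ^ k)"
    by (rule dvd_power_diff_prime_power[OF frobenius_int_poly_iterated[OF q(1)]])
  moreover have "(of_nat q :: int poly) ^ Suc k = of_int (int q ^ Suc k)" by simp
  ultimately show ?thesis using cyc_dvd_ev by metis
qed

text \<open>
  The Frobenius substitution fixes every prime ideal above \<open>q\<close>; this is its element-wise form,
  in which \<open>E\<close> replaces an idempotent that separates those prime ideals.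
\<close>

lemma cyc_dvd_galois_frobenius:
  assumes q: "Factorial_Ring.prime q" "q \<noteq> p" and s: "[s = q ^ e] (mod n)"
    and "x \<in> cyc_int" "w \<in> cyc_int" "cyc_dvd (int q ^ v) (x * w)"
  shows "cyc_dvd (int q ^ v) (galois s x * w)"
  using assms(4-)
proof (induction v arbitrary: x w)
  case 0
  have "\<not> p dvd q ^ e" using q prime_p by (metis prime_dvd_power primes_dvd_imp_eq)
  then have "\<not> p dvd s" using s p_dvd_cong by blast
  then show ?case using 0 by (simp add: cyc_dvd_def)
next
  case (Suc v)
  note x = \<open>x \<in> cyc_int\<close> and w = \<open>w \<in> cyc_int\<close>
  have "\<not> p dvd q ^ e" for e using q prime_p by (metis prime_dvd_power primes_dvd_imp_eq)
  then have ps: "\<not> p dvd s" and pq: "\<not> p dvd q" using s p_dvd_cong by (blast, metis power_one_right)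
  have q0: "q > 1" using q(1) prime_gt_1_nat by blast
  define g where "g = totient n"
  have g: "g > 0" using n_pos by (simp add: g_def)
  have qg: "[q ^ g = 1] (mod n)" unfolding g_def
    using pq by (intro euler_theorem) (simp add: coprime_n_iff)
  \<comment> \<open>Since \<open>N\<close> is 1 modulo \<open>n\<close>, the corresponding power of
    the Frobenius is trivial, and \<open>x ^ N\<close> is congruent to \<open>x\<close> modulo
    \<open>q\<close>.\<close>
  define N where "N = q ^ g"
  have N: "N > 1" using q0 g unfolding N_def by (rule one_less_power)
  \<comment> \<open>Modulo \<open>q\<close>, multiplication by \<open>E\<close> fixes
    \<open>x\<close>, as an idempotent would; the extra factor \<open>q ^ Suc v\<close> in the
    exponent makes the Frobenius congruence hold modulo a high enough power of
    \<open>q\<close>.\<close>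
  define E where "E = x ^ ((N - 1) * q ^ Suc v)"
  have E: "E \<in> cyc_int" using x by (simp add: E_def)
  have "galois N x = x"
    using galois_cong[OF qg] galois_one x by (simp add: N_def cyc_int_subset_cyc_rat)
  then have "cyc_dvd (int q) (x ^ N - x)"
    using galois_frobenius_cong[OF q x, of 0 g] by (simp add: N_def)
  then have "cyc_dvd (int q) (x * (1 - x ^ (N - 1)))"
  proof -
    assume "cyc_dvd (int q) (x ^ N - x)"
    then have "cyc_dvd (int q) (of_int (- 1) * (x ^ N - x))"
      by (rule cyc_dvd_mult_left) simp
    moreover have "x ^ N = x * x ^ (N - 1)" using N by (metis power_eq_if not_one_less_zero)
    ultimately show ?thesis by (simp add: algebra_simps)
  qed
  moreover have "1 - E = (1 - x ^ (N - 1)) * (\<Sum>i<q ^ Suc v. (x ^ (N - 1)) ^ i)"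
    unfolding E_def power_mult by (rule one_diff_power_eq)
  ultimately have "cyc_dvd (int q) (x * (1 - E))"
    using cyc_dvd_mult_right[of "int q" "x * (1 - x ^ (N - 1))" "\<Sum>i<q ^ Suc v. (x ^ (N - 1)) ^ i"] x
    by (simp add: cyc_int_sum mult.assoc)
  then obtain Z where Z: "Z \<in> cyc_int" "x * (1 - E) = of_nat q * Z"
    by (auto simp: cyc_dvd_def)
  \<comment> \<open>Passing from \<open>x\<close> to \<open>Z\<close> removes one factor
    \<open>q\<close>, so the induction hypothesis applies to \<open>Z\<close>.\<close>
  have ZW: "cyc_dvd (int q ^ v) (Z * w)"
  proof -
    obtain u where u: "u \<in> cyc_int" "x * w = of_int (int q ^ Suc v) * u"
      using Suc.prems by (auto simp: cyc_dvd_def)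
    have "of_nat q * (Z * w) = (of_nat q * Z) * w" by simp
    also have "\<dots> = (1 - E) * (x * w)" unfolding Z(2)[symmetric] by (simp only: mult_ac)
    also have "\<dots> = of_nat q * (of_int (int q ^ v) * ((1 - E) * u))"
      unfolding u(2) by (simp add: mult_ac)
    finally have "Z * w = of_int (int q ^ v) * ((1 - E) * u)" using q0 by simp
    then show ?thesis using E u(1) unfolding cyc_dvd_def by force
  qed
  have IH: "cyc_dvd (int q ^ v) (galois s Z * w)"
    by (rule Suc.IH[OF Z(1) w ZW])
  have gx: "galois s x = galois (q ^ e) x" by (rule galois_cong[OF s])
  \<comment> \<open>\<open>A\<close> and \<open>B\<close> agree modulo \<open>q ^ Suc v\<close>, and
    \<open>B\<close> contains the factor \<open>x\<close>, so \<open>B * w\<close> inherits the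
    divisibility of \<open>x * w\<close>.\<close>
  define A where "A = galois s x ^ (q ^ Suc v)"
  define B where "B = x ^ (q ^ e * q ^ Suc v)"
  have AB: "cyc_dvd (int q ^ Suc v) (A - B)"
  proof -
    have "cyc_dvd (int q ^ Suc (Suc v)) (B - A)"
      unfolding A_def B_def gx by (rule galois_frobenius_cong[OF q x])
    then have "cyc_dvd (int q ^ Suc (Suc v)) ((B - A) * of_int (- 1))"
      by (rule cyc_dvd_mult_right) simp
    moreover have "int q ^ Suc v dvd int q ^ Suc (Suc v)" by (simp add: le_imp_power_dvd)
    ultimately have "cyc_dvd (int q ^ Suc v) ((B - A) * of_int (- 1))"
      by (metis cyc_dvd_of_dvd)
    then show ?thesis by simp
  qed
  have A: "A \<in> cyc_int" using x ps by (simp add: A_def)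
  have AN: "galois s E = A ^ (N - 1)" "A ^ (N - 1) = A * A ^ (N - 2)"
  proof -
    have "galois s E = galois s x ^ ((N - 1) * q ^ Suc v)"
      unfolding E_def by (rule galois_power[OF ps cyc_int_subset_cyc_rat[OF x]])
    then show "galois s E = A ^ (N - 1)"
      by (simp only: A_def mult.commute[of "N - 1"] power_mult)
    have "N - 1 = Suc (N - 2)" using N by simp
    then show "A ^ (N - 1) = A * A ^ (N - 2)" by simp
  qed
  define C where "C = galois s x * A ^ (N - 2)"
  have C: "C \<in> cyc_int" using A x ps by (simp add: C_def)
  have gZ: "galois s x * (1 - A ^ (N - 1)) = of_nat q * galois s Z"
  proof -
    have "galois s (x * (1 - E)) = galois s (of_nat q * Z)" by (simp only: Z(2))
    then show ?thesis using ps x E Z(1)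
      by (simp add: galois_mult galois_diff cyc_int_subset_cyc_rat AN(1))
  qed
  have 1: "cyc_dvd (int q ^ Suc v) (C * (A - B) * w)"
    by (intro cyc_dvd_mult_right cyc_dvd_mult_left AB C w)
  have 2: "cyc_dvd (int q ^ Suc v) (C * B * w)"
  proof -
    have "q ^ e * q ^ Suc v > 0" using q0 by simp
    then have "B = x ^ (q ^ e * q ^ Suc v - 1) * x"
      unfolding B_def by (metis power_minus_mult)
    then have "C * B * w = (C * x ^ (q ^ e * q ^ Suc v - 1)) * (x * w)" by (simp only: mult_ac)
    then show ?thesis using Suc.prems C x by (simp only: cyc_dvd_mult_left cyc_int_mult cyc_int_power)
  qed
  have 3: "cyc_dvd (int q ^ Suc v) (of_nat q * (galois s Z * w))"
    using IH by (auto simp: cyc_dvd_def)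
  \<comment> \<open>Here \<open>A ^ (N - 1)\<close> is the image of \<open>E\<close>: the first
    summand is handled by replacing one factor \<open>A\<close> by \<open>B\<close>, the second is
    \<open>q\<close> times an element covered by the induction hypothesis.\<close>
  have "galois s x * w = galois s x * A ^ (N - 1) * w + galois s x * (1 - A ^ (N - 1)) * w"
    by (simp add: algebra_simps)
  also have "\<dots> = C * (A - B) * w + C * B * w + of_nat q * (galois s Z * w)"
    unfolding gZ unfolding AN(2) C_def by (simp add: algebra_simps)
  finally show ?case using 1 2 3 by (simp only: cyc_dvd_add)
qed

text \<open>The full prime powers in \<open>N\<close> are treated one at a time, each by its own
  Frobenius, and the coprime divisors are combined by Bezout.\<close>

lemma cyc_dvd_galois_of_prime_factors:
  assumes N: "N > 0" and x: "x \<in> cyc_int" "w \<in> cyc_int" and xw: "cyc_dvd (int N) (x * w)"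
    and s: "\<And>q. q \<in> prime_factors N \<Longrightarrow> q \<noteq> p \<and> (\<exists>e. [s = q ^ e] (mod n))"
    and ps: "\<not> p dvd s"
  shows "cyc_dvd (int N) (galois s x * w)"
proof -
  have "k dvd N \<Longrightarrow> cyc_dvd (int k) (galois s x * w)" for k
  proof (induction k rule: less_induct)
    case (less k)
    have k0: "k > 0" using less.prems N by (meson dvd_pos_nat)
    show ?case
    proof (cases "k = 1")
      case True
      then show ?thesis using x ps by (simp add: cyc_dvd_def)
    next
      case False
      then obtain q where q: "Factorial_Ring.prime q" "q dvd k" using prime_factor_nat by blast
      define v where "v = multiplicity q k"
      obtain k' where k': "k = q ^ v * k'" using multiplicity_dvd[of q k] by (auto simp: v_def)
      have v: "v > 0" unfolding v_def using q k0 by (simp add: prime_multiplicity_gt_zero_iff)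
      have "\<not> q dvd k'"
      proof
        assume "q dvd k'"
        then have "q ^ Suc v dvd k" by (simp add: k' mult.commute)
        moreover have "q \<noteq> 1" using q(1) by auto
        ultimately have "Suc v \<le> multiplicity q k"
          using k0 by (intro multiplicity_geI) auto
        then show False by (simp add: v_def)
      qed
      then have cop: "coprime (int q ^ v) (int k')"
        using q(1) by (metis coprime_int_iff coprime_power_left_iff of_nat_power prime_imp_coprime)
      have "q ^ v > 1" using v q(1) by (metis one_less_power prime_gt_1_nat)
      moreover have "k' > 0" using k0 k' by simp
      ultimately have "k' < k" using k' by simp
      moreover have "k' dvd N" using k' less.prems by (metis dvd_mult_right)
      ultimately have 1: "cyc_dvd (int k') (galois s x * w)" using less.IH by blast
      have "q \<in> prime_factors N"
        using q less.prems N by (metis dvd_trans in_prime_factors_iff less_irrefl)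
      then obtain e where "q \<noteq> p" "[s = q ^ e] (mod n)" using s by blast
      moreover have "cyc_dvd (int q ^ v) (x * w)"
      proof (rule cyc_dvd_of_dvd[OF _ xw])
        have "q ^ v dvd N" using k' less.prems by (metis dvd_mult_left)
        then show "int q ^ v dvd int N" by (metis of_nat_dvd_iff of_nat_power)
      qed
      ultimately have 2: "cyc_dvd (int q ^ v) (galois s x * w)"
        using cyc_dvd_galois_frobenius[OF q(1)] x by blast
      show ?thesis using cyc_dvd_coprime_mult[OF cop 2 1] by (simp add: k')
    qed
  qed
  then show ?thesis by simp
qed

end

subsection \<open>Cyclotomic integers whose conjugates have modulus 1\<close>

lemma ev_altdef: "ev P w = (\<Sum>i\<le>degree P. of_int (coeff P i) * w ^ i)"
  by (simp add: ev_def poly_altdef coeff_map_poly degree_map_poly)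

text \<open>Injectivity makes \<open>\<omega>\<close> a primitive \<open>N\<close>-th root of unity;
  the identity is Parseval's for the discrete Fourier transform of \<open>c\<close>, from
  orthogonality of its powers.\<close>

lemma parseval_roots_of_unity:
  fixes c :: "nat \<Rightarrow> real"
  assumes N: "N > 0" and \<omega>: "\<omega> ^ N = 1" and inj: "inj_on (\<lambda>i. \<omega> ^ i) {..<N}"
  shows "(\<Sum>t<N. (cmod (\<Sum>i<N. of_real (c i) * \<omega> ^ (t * i)))\<^sup>2) = N * (\<Sum>i<N. (c i)\<^sup>2)"
proof -
  have norm1: "cmod \<omega> = 1" using \<omega> N by (metis norm_one norm_power power_eq_1_iff norm_ge_zero less_irrefl)
  have orth: "(\<Sum>t<N. \<omega> ^ (t * i) * cnj \<omega> ^ (t * j)) = (if i = j then of_nat N else 0)"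
    if ij: "i < N" "j < N" for i j
  proof -
    \<comment> \<open>This is the power of \<open>\<omega>\<close> with exponent
      \<open>i - j\<close>; the geometric sum over its powers vanishes unless it is 1.\<close>
    define \<rho> where "\<rho> = \<omega> ^ i * cnj \<omega> ^ j"
    have wc: "\<omega> * cnj \<omega> = 1" using complex_norm_square[of \<omega>] norm1 by simp
    have "cnj \<omega> ^ N = 1" using \<omega> by (metis complex_cnj_one complex_cnj_power)
    then have \<rho>N: "\<rho> ^ N = 1" using \<omega>
      by (simp add: \<rho>_def power_mult_distrib flip: power_mult) (simp add: power_mult mult.commute[of _ N])
    have sum: "(\<Sum>t<N. \<omega> ^ (t * i) * cnj \<omega> ^ (t * j)) = (\<Sum>t<N. \<rho> ^ t)"
      by (simp add: \<rho>_def power_mult_distrib flip: power_mult) (simp add: mult.commute)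
    show ?thesis
    proof (cases "i = j")
      case True
      then have "\<rho> = 1" using wc by (simp add: \<rho>_def flip: power_mult_distrib)
      then show ?thesis using True sum by simp
    next
      case False
      have "\<rho> \<noteq> 1"
      proof
        assume "\<rho> = 1"
        then have "\<omega> ^ j = \<omega> ^ i * (\<omega> * cnj \<omega>) ^ j"
          by (simp add: \<rho>_def power_mult_distrib mult.left_commute)
        then have "\<omega> ^ j = \<omega> ^ i" using wc by simp
        then show False using inj ij False by (auto dest: inj_onD)
      qed
      then show ?thesis using False sum \<rho>N by (simp add: geometric_sum)
    qed
  qed
  have "complex_of_real (\<Sum>t<N. (cmod (\<Sum>i<N. of_real (c i) * \<omega> ^ (t * i)))\<^sup>2)
      = (\<Sum>t<N. (\<Sum>i<N. of_real (c i) * \<omega> ^ (t * i)) * cnj (\<Sum>j<N. of_real (c j) * \<omega> ^ (t * j)))"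
    by (simp add: complex_norm_square del: of_real_power)
  also have "\<dots> = (\<Sum>t<N. \<Sum>i<N. \<Sum>j<N. of_real (c i) * of_real (c j) * (\<omega> ^ (t * i) * cnj \<omega> ^ (t * j)))"
    by (simp add: sum_product mult_ac)
  also have "\<dots> = (\<Sum>i<N. \<Sum>t<N. \<Sum>j<N. of_real (c i) * of_real (c j) * (\<omega> ^ (t * i) * cnj \<omega> ^ (t * j)))"
    by (rule sum.swap)
  also have "\<dots> = (\<Sum>i<N. \<Sum>j<N. of_real (c i) * of_real (c j) * (\<Sum>t<N. \<omega> ^ (t * i) * cnj \<omega> ^ (t * j)))"
    unfolding sum_distrib_left by (intro sum.cong refl sum.swap)
  also have "\<dots> = (\<Sum>i<N. \<Sum>j<N. of_real (c i) * of_real (c j) * (if i = j then of_nat N else 0))"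
    by (intro sum.cong refl) (simp add: orth)
  also have "\<dots> = (\<Sum>i<N. of_real (c i) * of_real (c i) * of_nat N)"
    by (intro sum.cong refl) (simp add: if_distrib sum.delta cong: if_cong)
  also have "\<dots> = complex_of_real (N * (\<Sum>i<N. (c i)\<^sup>2))"
    by (simp add: sum_distrib_left power2_eq_square mult_ac)
  finally show ?thesis using of_real_eq_iff by blast
qed

lemma sum_squares_eq_1_int:
  fixes c :: "'a \<Rightarrow> int"
  assumes "finite A" and "(\<Sum>i\<in>A. (c i)\<^sup>2) = 1"
  shows "\<exists>i\<in>A. (c i = 1 \<or> c i = -1) \<and> (\<forall>j\<in>A - {i}. c j = 0)"
proof -
  obtain i where i: "i \<in> A" "c i \<noteq> 0"
    using assms(2) by (metis (mono_tags, lifting) power_zero_numeral sum.neutral zero_neq_one)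
  have eq: "(c i)\<^sup>2 + (\<Sum>j\<in>A - {i}. (c j)\<^sup>2) = 1"
    using assms i by (simp add: sum.remove)
  have nn: "(\<Sum>j\<in>A - {i}. (c j)\<^sup>2) \<ge> 0" by (simp add: sum_nonneg)
  have ge: "(c i)\<^sup>2 \<ge> 1" using i(2) by (smt (verit) zero_less_power2)
  have "(\<Sum>j\<in>A - {i}. (c j)\<^sup>2) = 0" "(c i)\<^sup>2 = 1" using eq nn ge by linarith+
  then show ?thesis using i(1) assms(1)
    by (intro bexI[of _ i]) (auto simp: sum_nonneg_eq_0_iff power2_eq_1_iff)
qed

lemma sum_lessThan_mult_nat:
  fixes f :: "nat \<Rightarrow> 'a::comm_monoid_add"
  shows "(\<Sum>i<a * b. f i) = (\<Sum>j<a. \<Sum>l<b. f (j + a * l))"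
proof -
  have "(\<Sum>i<a * b. f i) = (\<Sum>l<b. sum f {l * a..<l * a + a})"
    by (simp add: sum.nat_group mult.commute)
  also have "\<dots> = (\<Sum>l<b. \<Sum>j<a. f (j + a * l))"
  proof (rule sum.cong[OF refl])
    fix l :: nat
    have "sum f {0 + l * a..<a + l * a} = (\<Sum>j\<in>{0..<a}. f (j + l * a))"
      by (rule sum.shift_bounds_nat_ivl)
    then show "sum f {l * a..<l * a + a} = (\<Sum>j<a. f (j + a * l))"
      by (simp add: add.commute mult.commute atLeast0LessThan)
  qed
  also have "\<dots> = (\<Sum>j<a. \<Sum>l<b. f (j + a * l))" by (rule sum.swap)
  finally show ?thesis .
qed

context prime_power_cyclotomic
begin

definition n' :: nat where "n' = p ^ (r - 1)"

lemma n_eq: "n = n' * p"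
  using r_pos by (simp add: n_def n'_def power_eq_if)

lemma n'_pos: "n' > 0"
  using p_pos by (simp add: n'_def)

text \<open>\<open>z ^ n'\<close> is a primitive \<open>p\<close>-th root of unity. These relations
  are the freedom used to balance coefficients.\<close>

lemma sum_coset_zero: "(\<Sum>l<p. z ^ (j + n' * l)) = 0"
proof -
  have "z ^ n' \<noteq> 1" using p_gt_2 n'_pos
    by (simp add: z_power_eq_1_iff n_eq)
  moreover have "(z ^ n') ^ p = 1" by (simp flip: power_mult n_eq)
  ultimately have "(\<Sum>l<p. (z ^ n') ^ l) = 0" by (simp add: geometric_sum)
  then show ?thesis by (simp add: power_add power_mult flip: sum_distrib_left)
qed

lemma cyc_int_balanced_coefficients:
  assumes "x \<in> cyc_int"
  shows "\<exists>c::nat \<Rightarrow> int. x = (\<Sum>i<n. of_int (c i) * z ^ i) \<and>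
    (\<forall>j<n'. 2 * \<bar>\<Sum>l<p. c (j + n' * l)\<bar> \<le> int p - 1)"
proof -
  obtain P where P: "x = ev P z" using assms by (rule cyc_intE)
  \<comment> \<open>Exponents are first folded modulo \<open>n\<close>.\<close>
  define c where "c j = (\<Sum>i | i \<in> {..degree P} \<and> i mod n = j. coeff P i)" for j
  have "x = (\<Sum>i\<in>{..degree P}. of_int (coeff P i) * z ^ i)" by (simp add: P ev_altdef)
  also have "\<dots> = (\<Sum>j<n. \<Sum>i | i \<in> {..degree P} \<and> i mod n = j. of_int (coeff P i) * z ^ i)"
    using n_pos by (subst sum.group) auto
  also have "\<dots> = (\<Sum>j<n. of_int (c j) * z ^ j)"
  proof (intro sum.cong refl)
    fix j
    have "(\<Sum>i | i \<in> {..degree P} \<and> i mod n = j. of_int (coeff P i) * z ^ i)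
        = (\<Sum>i | i \<in> {..degree P} \<and> i mod n = j. of_int (coeff P i) * z ^ j)"
      by (intro sum.cong refl) (auto simp: z_power_mod)
    then show "(\<Sum>i | i \<in> {..degree P} \<and> i mod n = j. of_int (coeff P i) * z ^ i) = of_int (c j) * z ^ j"
      by (simp add: c_def sum_distrib_right)
  qed
  finally have xc: "x = (\<Sum>j<n. of_int (c j) * z ^ j)" .
  define S where "S j = (\<Sum>l<p. c (j + n' * l))" for j
  \<comment> \<open>The integer nearest to \<open>S j / p\<close>. Subtracting it from all
    \<open>p\<close> coefficients in the class of \<open>j\<close> modulo \<open>n'\<close> does not
    change \<open>x\<close>, but leaves a coset sum of absolute value at most
    \<open>(p - 1) / 2\<close>; this uses that \<open>p\<close> is odd.\<close>
  define k where "k j = (S j + (int p - 1) div 2) div int p" for j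
  define c' where "c' i = c i - k (i mod n')" for i
  have "(\<Sum>i<n. of_int (k (i mod n')) * z ^ i)
      = (\<Sum>j<n'. \<Sum>l<p. of_int (k ((j + n' * l) mod n')) * z ^ (j + n' * l))"
    unfolding n_eq by (rule sum_lessThan_mult_nat)
  also have "\<dots> = (\<Sum>j<n'. of_int (k j) * (\<Sum>l<p. z ^ (j + n' * l)))"
    by (intro sum.cong refl) (simp add: sum_distrib_left)
  also have "\<dots> = 0" by (simp add: sum_coset_zero)
  finally have "x = (\<Sum>i<n. of_int (c' i) * z ^ i)"
    by (simp add: xc c'_def algebra_simps sum_subtractf)
  moreover have "2 * \<bar>\<Sum>l<p. c' (j + n' * l)\<bar> \<le> int p - 1" if "j < n'" for j
  proof -
    have "(\<Sum>l<p. c' (j + n' * l)) = S j - int p * k j"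
      using that by (simp add: c'_def S_def sum_subtractf)
    moreover have "odd p" using prime_p p_gt_2 by (metis prime_odd_nat)
    then have "2 * ((int p - 1) div 2) = int p - 1" by simp
    moreover have "int p * k j = (S j + (int p - 1) div 2) - (S j + (int p - 1) div 2) mod int p"
      unfolding k_def by (simp add: minus_mod_eq_mult_div)
    moreover have "0 \<le> (S j + (int p - 1) div 2) mod int p"
      "(S j + (int p - 1) div 2) mod int p < int p" using p_pos by simp_all
    ultimately show ?thesis by linarith
  qed
  ultimately show ?thesis by blast
qed

text \<open>
  A refinement of Kronecker's theorem for prime power conductor: comparing the sums of
  \<open>\<bar>w(z\<^sup>t)\<bar>\<^sup>2\<close> over all \<open>t\<close> and over the multiples \<open>t\<close> of \<open>p\<close> bounds the sum of the squared
  coefficients of \<open>w\<close>, once these are balanced modulo the relations \<open>sum_coset_zero\<close>.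
\<close>

lemma all_conjugates_unit_modulus:
  assumes w: "w \<in> cyc_int" and norm: "\<And>t. \<not> p dvd t \<Longrightarrow> cmod (galois t w) = 1"
  shows "\<exists>c. w = z ^ c \<or> w = - (z ^ c)"
proof -
  obtain c :: "nat \<Rightarrow> int" where wc: "w = (\<Sum>i<n. of_int (c i) * z ^ i)"
    and bal: "\<And>j. j < n' \<Longrightarrow> 2 * \<bar>\<Sum>l<p. c (j + n' * l)\<bar> \<le> int p - 1"
    using cyc_int_balanced_coefficients[OF w] by blast
  define F where "F t = (\<Sum>i<n. of_real (of_int (c i)) * z ^ (t * i))" for t
  define S where "S j = (\<Sum>l<p. c (j + n' * l))" for j
  have "w = ev (\<Sum>i<n. monom (c i) i) z" by (simp add: wc)
  then have F: "galois t w = F t" if "\<not> p dvd t" for t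
    using galois_ev[OF that, of "\<Sum>i<n. monom (c i) i"] by (simp add: F_def power_mult)
  have inj: "inj_on (\<lambda>i. z ^ i) {..<n}" using roots_of_unity_bij bij_betw_def by blast
  have 1: "(\<Sum>t<n. (cmod (F t))\<^sup>2) = n * (\<Sum>i<n. (real_of_int (c i))\<^sup>2)"
    unfolding F_def by (rule parseval_roots_of_unity[OF n_pos z_power_n inj])
  \<comment> \<open>At multiples of \<open>p\<close> only the index modulo \<open>n'\<close>
    matters, so the values there are the Fourier transform of the coset sums
    \<open>S\<close>.\<close>
  have Fp: "F (p * t) = (\<Sum>j<n'. of_real (of_int (S j)) * (z ^ p) ^ (t * j))" for t
  proof -
    have "F (p * t) = (\<Sum>j<n'. \<Sum>l<p. of_real (of_int (c (j + n' * l))) * z ^ (p * t * (j + n' * l)))"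
      unfolding F_def n_eq by (rule sum_lessThan_mult_nat)
    also have "\<dots> = (\<Sum>j<n'. \<Sum>l<p. of_real (of_int (c (j + n' * l))) * (z ^ p) ^ (t * j))"
    proof (intro sum.cong refl)
      fix j l
      have "[p * t * (j + n' * l) = p * (t * j)] (mod n)"
      proof -
        have "p * t * (j + n' * l) = p * (t * j) + n * (t * l)" by (simp add: n_eq algebra_simps)
        then show ?thesis by (simp add: cong_def)
      qed
      then have "z ^ (p * t * (j + n' * l)) = z ^ (p * (t * j))" by (simp add: z_power_eq_iff)
      then show "of_real (of_int (c (j + n' * l))) * z ^ (p * t * (j + n' * l))
          = of_real (of_int (c (j + n' * l))) * (z ^ p) ^ (t * j)" by (simp add: power_mult)
    qed
    also have "\<dots> = (\<Sum>j<n'. of_real (of_int (S j)) * (z ^ p) ^ (t * j))"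
      by (simp add: S_def sum_distrib_right)
    finally show ?thesis .
  qed
  have "inj_on (\<lambda>i. (z ^ p) ^ i) {..<n'}"
  proof (rule inj_onI)
    fix i j assume ij: "i \<in> {..<n'}" "j \<in> {..<n'}" "(z ^ p) ^ i = (z ^ p) ^ j"
    then have "z ^ (p * i) = z ^ (p * j)" by (simp add: power_mult)
    moreover have "p * i < n" "p * j < n" using ij p_pos by (simp_all add: n_eq mult.commute)
    ultimately have "p * i = p * j" using inj by (auto dest: inj_onD)
    then show "i = j" using p_pos by simp
  qed
  moreover have "(z ^ p) ^ n' = 1"
    unfolding power_mult[symmetric] using n_eq z_power_n by (simp add: mult.commute)
  ultimately have 2: "(\<Sum>t<n'. (cmod (F (p * t)))\<^sup>2) = n' * (\<Sum>j<n'. (real_of_int (S j))\<^sup>2)"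
    unfolding Fp using n'_pos by (intro parseval_roots_of_unity) auto
  \<comment> \<open>The remaining \<open>n' * (p - 1)\<close> values are conjugates of
    \<open>w\<close> and have modulus 1.\<close>
  have 3: "(\<Sum>t<n. (cmod (F t))\<^sup>2) = (\<Sum>t<n'. (cmod (F (p * t)))\<^sup>2) + real n' * (real p - 1)"
  proof -
    have "(\<Sum>t<n. (cmod (F t))\<^sup>2) = (\<Sum>l<n'. \<Sum>j<p. (cmod (F (j + p * l)))\<^sup>2)"
      unfolding n_eq mult.commute[of n'] sum_lessThan_mult_nat by (rule sum.swap)
    also have "\<dots> = (\<Sum>l<n'. (cmod (F (p * l)))\<^sup>2 + (real p - 1))"
    proof (intro sum.cong refl)
      fix l
      have "{..<p} = insert 0 {1..<p}" using p_pos by auto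
      then have "(\<Sum>j<p. (cmod (F (j + p * l)))\<^sup>2)
          = (cmod (F (p * l)))\<^sup>2 + (\<Sum>j\<in>{1..<p}. (cmod (F (j + p * l)))\<^sup>2)" by simp
      also have "(\<Sum>j\<in>{1..<p}. (cmod (F (j + p * l)))\<^sup>2) = (\<Sum>j\<in>{1..<p}. 1)"
      proof (intro sum.cong refl)
        fix j assume "j \<in> {1..<p}"
        then have "\<not> p dvd j + p * l" by (auto simp: dvd_add_left_iff dest: dvd_imp_le)
        then show "(cmod (F (j + p * l)))\<^sup>2 = 1" using norm F by simp
      qed
      also have "\<dots> = real p - 1" using p_pos by (simp add: of_nat_diff)
      finally show "(\<Sum>j<p. (cmod (F (j + p * l)))\<^sup>2) = (cmod (F (p * l)))\<^sup>2 + (real p - 1)" .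
    qed
    finally show ?thesis by (simp add: sum.distrib)
  qed
  define A where "A = (\<Sum>i<n. (c i)\<^sup>2)"
  define B where "B = (\<Sum>j<n'. (S j)\<^sup>2)"
  have "real n' * (real p * of_int A) = real n' * (of_int B + (real p - 1))"
    using 1 2 3 unfolding n_eq A_def B_def by (simp add: algebra_simps)
  then have "real p * of_int A = of_int B + (real p - 1)" using n'_pos by simp
  then have "real_of_int (int p * A) = real_of_int (B + (int p - 1))" by simp
  then have AB: "int p * A = B + (int p - 1)" by (simp only: of_int_eq_iff)
  \<comment> \<open>One factor \<open>\<bar>S j\<bar>\<close> is bounded by balancedness, the other
    by the sum of squares, since \<open>\<bar>y\<bar> \<le> y\<^sup>2\<close> for integers. Together
    with \<open>AB\<close> this forces \<open>A < 2\<close>, so a single coefficient survives and it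
    is 1 or -1.\<close>
  have "2 * B \<le> (int p - 1) * A"
  proof -
    have A': "A = (\<Sum>j<n'. \<Sum>l<p. (c (j + n' * l))\<^sup>2)"
      unfolding A_def n_eq by (rule sum_lessThan_mult_nat)
    have "2 * (S j)\<^sup>2 \<le> (int p - 1) * (\<Sum>l<p. (c (j + n' * l))\<^sup>2)" if "j < n'" for j
    proof -
      have abs_le: "\<bar>y\<bar> \<le> y\<^sup>2" for y :: int
      proof (cases "y = 0")
        case False
        then have "\<bar>y\<bar> * 1 \<le> \<bar>y\<bar> * \<bar>y\<bar>" by (intro mult_left_mono) auto
        then show ?thesis by (simp add: power2_eq_square)
      qed simp
      have "\<bar>S j\<bar> \<le> (\<Sum>l<p. \<bar>c (j + n' * l)\<bar>)" unfolding S_def by (rule sum_abs)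
      moreover have "(\<Sum>l<p. \<bar>c (j + n' * l)\<bar>) \<le> (\<Sum>l<p. (c (j + n' * l))\<^sup>2)"
        by (intro sum_mono abs_le)
      ultimately have "\<bar>S j\<bar> \<le> (\<Sum>l<p. (c (j + n' * l))\<^sup>2)" by linarith
      moreover have "2 * \<bar>S j\<bar> \<le> int p - 1" using bal[OF that] by (simp add: S_def)
      ultimately have "(2 * \<bar>S j\<bar>) * \<bar>S j\<bar> \<le> (int p - 1) * (\<Sum>l<p. (c (j + n' * l))\<^sup>2)"
        using p_pos by (intro mult_mono) auto
      then show ?thesis by (simp add: power2_eq_square)
    qed
    then show ?thesis unfolding A' B_def sum_distrib_left by (intro sum_mono) auto
  qed
  then have le: "(int p + 1) * A \<le> 2 * (int p - 1)" using AB by (simp add: algebra_simps)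
  have "A < 2"
  proof (rule ccontr)
    assume "\<not> A < 2"
    then have "(int p + 1) * 2 \<le> (int p + 1) * A" by (intro mult_left_mono) simp_all
    then have "(int p + 1) * 2 \<le> 2 * (int p - 1)" using le by (rule order_trans)
    then show False by simp
  qed
  moreover have "A \<noteq> 0"
  proof
    assume "A = 0"
    then have "\<forall>i\<in>{..<n}. c i = 0" unfolding A_def by (subst (asm) sum_nonneg_eq_0_iff) auto
    then have "w = 0" by (simp add: wc)
    then show False using norm[of 1] p_gt_2 by simp
  qed
  moreover have "A \<ge> 0" by (simp add: A_def sum_nonneg)
  ultimately have "A = 1" by simp
  then obtain i where i: "i < n" "c i = 1 \<or> c i = -1" "\<forall>j\<in>{..<n} - {i}. c j = 0"
    using sum_squares_eq_1_int[of "{..<n}" c] by (auto simp: A_def)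
  have "w = of_int (c i) * z ^ i + (\<Sum>j\<in>{..<n} - {i}. of_int (c j) * z ^ j)"
    unfolding wc using i(1) by (intro sum.remove) auto
  also have "(\<Sum>j\<in>{..<n} - {i}. of_int (c j) * z ^ j) = (0::complex)"
    using i(3) by (intro sum.neutral) auto
  finally show ?thesis using i(2) by auto
qed

end

subsection \<open>Automorphisms acting by roots of unity\<close>

text \<open>Lagrange's theorem for a closed set of units: multiplication by \<open>s\<close>
  permutes \<open>S\<close>, and the product over \<open>S\<close> cancels.\<close>

lemma closed_residues_power_card:
  fixes m :: nat
  assumes S: "S \<subseteq> {..<m}" "\<And>s. s \<in> S \<Longrightarrow> coprime s m"
    and closed: "\<And>s t. s \<in> S \<Longrightarrow> t \<in> S \<Longrightarrow> s * t mod m \<in> S"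
    and s: "s \<in> S"
  shows "[s ^ card S = 1] (mod m)"
proof -
  have fin: "finite S" using S(1) finite_subset by blast
  have inj: "inj_on (\<lambda>x. s * x mod m) S"
  proof (rule inj_onI)
    fix x y assume xy: "x \<in> S" "y \<in> S" "s * x mod m = s * y mod m"
    then have "[x = y] (mod m)" using S(2)[OF s] by (simp add: cong_def[symmetric] cong_mult_lcancel_nat)
    then show "x = y" using xy S(1) by (metis cong_def lessThan_iff mod_less subsetD)
  qed
  have "(\<lambda>x. s * x mod m) ` S = S"
    using closed[OF s] inj fin by (intro endo_inj_surj) auto
  then have "(\<Prod>x\<in>S. x) = (\<Prod>x\<in>S. s * x mod m)"
    using prod.reindex[OF inj, of "\<lambda>x. x"] by simp
  moreover have "[(\<Prod>x\<in>S. s * x mod m) = (\<Prod>x\<in>S. s * x)] (mod m)"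
    by (rule cong_prod) (simp add: cong_def)
  ultimately have "[s ^ card S * \<Prod>S = 1 * \<Prod>S] (mod m)"
    by (simp add: prod.distrib cong_sym)
  moreover have "coprime (\<Prod>S) m" using S(2) by (intro prod_coprime_left) auto
  ultimately show ?thesis using cong_mult_rcancel_nat by blast
qed

text \<open>In a cyclic group, the subgroup generated by \<open>q\<close> contains every element
  whose order divides that of \<open>q\<close>. With a primitive root \<open>g\<close>, this becomes
  solvability of a linear congruence between exponents.\<close>

lemma cong_power_of_power_eq_1:
  fixes m :: nat
  assumes g: "residue_primroot m g" and m: "m > 1"
    and q: "coprime q m" and s: "coprime s m" and sq: "[s ^ ord m q = 1] (mod m)"
  shows "\<exists>e. [s = q ^ e] (mod m)"
proof -
  have gen: "\<exists>i. [a = g ^ i] (mod m)" if "coprime a m" for a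
  proof -
    have "coprime (a mod m) m" using that m by simp
    moreover from this have "a mod m > 0" using m by (cases "a mod m = 0") auto
    moreover have "a mod m \<le> m" using m by (simp add: less_imp_le)
    ultimately have "a mod m \<in> totatives m" by (simp add: totatives_def)
    then obtain i where "a mod m = g ^ i mod m"
      using residue_primroot_is_generator[OF m g] by (auto simp: bij_betw_def)
    then show ?thesis by (auto simp: cong_def)
  qed
  obtain i where i: "[s = g ^ i] (mod m)" using gen[OF s] by blast
  obtain j where j: "[q = g ^ j] (mod m)" using gen[OF q] by blast
  define \<phi> where "\<phi> = totient m"
  have \<phi>: "\<phi> > 0" using m by (simp add: \<phi>_def)
  have ordg: "ord m g = \<phi>" using g by (simp add: residue_primroot_def \<phi>_def)
  have gk: "[g ^ k = 1] (mod m) \<longleftrightarrow> \<phi> dvd k" for k by (simp only: ord_divides ordg)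
  \<comment> \<open>The order of \<open>q\<close> divides \<open>\<phi> div d\<close>, which forces
    \<open>d\<close> to divide \<open>i\<close> and makes \<open>j * e = i\<close> solvable modulo
    \<open>\<phi>\<close>.\<close>
  define d where "d = gcd j \<phi>"
  have d: "d > 0" "d dvd j" "d dvd \<phi>" using \<phi> by (simp_all add: d_def)
  have "[q ^ (\<phi> div d) = g ^ (j * (\<phi> div d))] (mod m)"
    using j by (simp add: power_mult cong_pow)
  moreover have "\<phi> dvd j * (\<phi> div d)"
    using d by (metis div_mult_swap dvd_div_mult dvd_triv_right mult.commute)
  ultimately have "[q ^ (\<phi> div d) = 1] (mod m)" using gk cong_trans by blast
  then have "ord m q dvd \<phi> div d" by (simp only: ord_divides dvd_refl)
  then have "[s ^ (\<phi> div d) = 1] (mod m)" using sq by (meson dvd_trans ord_divides)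
  moreover have "[s ^ (\<phi> div d) = g ^ (i * (\<phi> div d))] (mod m)"
    using i by (simp add: power_mult cong_pow)
  ultimately have "\<phi> dvd i * (\<phi> div d)" using gk cong_sym cong_trans by meson
  then have "d * (\<phi> div d) dvd i * (\<phi> div d)" using d by simp
  moreover have "\<phi> div d > 0" using d \<phi> by (metis dvd_div_eq_0_iff gr0I less_irrefl)
  ultimately have "d dvd i" by simp
  then obtain e where "[j * e = i] (mod \<phi>)" unfolding d_def using cong_solve_dvd_nat by blast
  then have "[g ^ (j * e) = g ^ i] (mod m)"
    using order_divides_expdiff[of m g "j * e" i] g ordg by (simp add: residue_primroot_def)
  then have "[s = q ^ e] (mod m)"
    using i cong_pow[OF j, of e] by (metis cong_sym cong_trans power_mult)
  then show ?thesis by blast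
qed

context prime_power_cyclotomic
begin

text \<open>Automorphisms commute with conjugation and fix the integer \<open>N\<close>.\<close>

lemma galois_norm:
  assumes y: "y \<in> cyc_int" "y * cnj y = of_nat N" and t: "\<not> p dvd t"
  shows "(cmod (galois t y))\<^sup>2 = N"
proof -
  have "galois t y * cnj (galois t y) = galois t (y * cnj y)"
    using y(1) t by (simp add: cnj_galois galois_mult cyc_int_subset_cyc_rat)
  then have "complex_of_real ((cmod (galois t y))\<^sup>2) = of_nat N"
    using y(2) t by (simp only: complex_norm_square) simp
  then show ?thesis by (metis of_real_eq_iff of_real_of_nat_eq)
qed

text \<open>Each Frobenius at a prime factor of \<open>N\<close> has the given automorphism as a
  power, so \<open>N\<close> divides \<open>galois s y * cnj y\<close>. The quotient
  \<open>u\<close> equals \<open>galois s y / y\<close>, and its conjugates have modulus 1.\<close>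

lemma galois_eq_z_power_mult:
  assumes y: "y \<in> cyc_int" "y * cnj y = of_nat N" and N: "N > 0" "\<not> p dvd N"
    and s: "\<not> p dvd s" "\<And>q. q \<in> prime_factors N \<Longrightarrow> \<exists>e. [s = q ^ e] (mod n)"
  shows "\<exists>c. galois s y = z ^ c * y"
proof -
  have rat: "y \<in> cyc_rat" using y(1) by (rule cyc_int_subset_cyc_rat)
  have "cyc_dvd (int N) (galois s y * cnj y)"
  proof (rule cyc_dvd_galois_of_prime_factors[OF N(1) y(1) _ _ _ s(1)])
    show "cnj y \<in> cyc_int" using y(1) by simp
    show "cyc_dvd (int N) (y * cnj y)"
      unfolding cyc_dvd_def y(2) by (rule bexI[of _ 1]) simp_all
    fix q assume q: "q \<in> prime_factors N"
    then show "q \<noteq> p \<and> (\<exists>e. [s = q ^ e] (mod n))" using s(2) N(2) by auto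
  qed
  then obtain u where u: "u \<in> cyc_int" "galois s y * cnj y = of_nat N * u"
    by (auto simp: cyc_dvd_def)
  have "cmod (galois t u) = 1" if t: "\<not> p dvd t" for t
  proof -
    have ts: "\<not> p dvd t * s" using t s(1) prime_p by (simp add: prime_dvd_mult_iff)
    have "galois t (galois s y * cnj y) = galois t (of_nat N * u)" by (simp only: u(2))
    then have "galois (t * s) y * cnj (galois t y) = of_nat N * galois t u"
      using t s(1) rat u(1) by (simp add: galois_mult cyc_rat_galois cnj_galois cyc_int_subset_cyc_rat)
    then have "cmod (galois (t * s) y) * cmod (galois t y) = N * cmod (galois t u)"
      by (metis complex_mod_cnj norm_mult norm_of_nat)
    then have "(cmod (galois (t * s) y))\<^sup>2 * (cmod (galois t y))\<^sup>2 = (N * cmod (galois t u))\<^sup>2"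
      by (metis power_mult_distrib)
    then have "real N * real N = (N * cmod (galois t u))\<^sup>2"
      using galois_norm[OF y] t ts by simp
    then have "(cmod (galois t u))\<^sup>2 = 1" using N(1) by (simp add: power2_eq_square)
    then show ?thesis by (simp add: power2_eq_1_iff) (metis norm_ge_zero not_one_le_zero neg_0_le_iff_le)
  qed
  then obtain c where c: "u = z ^ c \<or> u = - (z ^ c)"
    using all_conjugates_unit_modulus[OF u(1)] by blast
  have "of_nat N * galois s y = (galois s y * cnj y) * y" by (simp flip: y(2))
  also have "\<dots> = of_nat N * (u * y)" by (simp add: u(2))
  finally have gy: "galois s y = u * y" using N(1) by simp
  \<comment> \<open>Setting \<open>z\<close> to 1 modulo \<open>p\<close>, a minus sign would give
    \<open>2 * P(1) = 0\<close>, whereas the square of \<open>P(1)\<close> is \<open>N\<close>,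
    which is nonzero modulo \<open>p\<close>.\<close>
  have "u \<noteq> - (z ^ c)"
  proof
    assume neg: "u = - (z ^ c)"
    obtain P where P: "y = ev P z" using y(1) by (rule cyc_intE)
    have "ev (pcompose P (monom 1 s) + monom 1 c * P) z = 0"
      using gy s(1) by (simp add: P neg galois_ev)
    then have "int p dvd poly (pcompose P (monom 1 s) + monom 1 c * P) 1"
      by (rule prime_dvd_poly_1)
    then have "int p dvd 2 * poly P 1" by (simp add: poly_pcompose poly_monom)
    moreover have "\<not> int p dvd 2" using p_gt_2 by (auto dest: zdvd_imp_le)
    ultimately have pP: "int p dvd poly P 1" using prime_p by (simp add: prime_dvd_mult_iff)
    have "ev (P * pcompose P (monom 1 (n - 1)) - [:int N:]) z = 0"
      using y(2) by (simp add: P cnj_ev cnj_z)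
    then have "int p dvd poly (P * pcompose P (monom 1 (n - 1)) - [:int N:]) 1"
      by (rule prime_dvd_poly_1)
    then have "int p dvd poly P 1 * poly P 1 - int N" by (simp add: poly_pcompose poly_monom)
    then have "int p dvd int N" using pP
      by (metis dvd_diff_right_iff dvd_mult)
    then show False using N(2) by simp
  qed
  then show ?thesis using c gy by blast
qed

text \<open>Residues modulo \<open>n\<close> that are 1 modulo \<open>p\<close> have order dividing
  the \<open>p\<close>-power \<open>n'\<close>; an order that also divides \<open>p - 1\<close> is
  1.\<close>

lemma eq_1_if_power_dvd_p_minus_1:
  assumes s: "[s = 1] (mod p)" "[s ^ f = 1] (mod n)" and f: "f dvd p - 1"
  shows "[s = 1] (mod n)"
proof -
  have "ord n s dvd p - 1" using s(2) f by (meson dvd_trans ord_divides)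
  moreover have "ord n s dvd n'"
  proof -
    have "int p dvd int s - int 1" using s(1) by (metis cong_iff_dvd_diff cong_int_iff)
    then have "int p ^ Suc (r - 1) dvd int s ^ p ^ (r - 1) - int 1 ^ p ^ (r - 1)"
      using dvd_power_diff_prime_power[of p "int s" "int 1" "r - 1"] by simp
    then have "int n dvd int (s ^ n') - int 1"
      using r_pos by (simp add: n_def n'_def)
    then have "[s ^ n' = 1] (mod n)" by (metis cong_iff_dvd_diff cong_int_iff)
    then show ?thesis by (simp only: ord_divides dvd_refl)
  qed
  moreover have "coprime (p - 1) n'"
  proof -
    have "coprime (p - 1) p" using p_pos by (metis Suc_pred' coprime_Suc_right_nat)
    then show ?thesis by (simp add: n'_def)
  qed
  ultimately have "ord n s = 1" by (metis coprime_common_divisor_nat is_unit_gcd One_nat_def)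
  then show ?thesis using ord_works[of s n] by simp
qed

text \<open>One automorphism \<open>t\<close> that is nontrivial modulo \<open>p\<close> determines
  the twist, because \<open>t - 1\<close> is invertible modulo \<open>n\<close>. The others commute
  with it, which forces their multipliers to be 1 as well.\<close>

lemma exists_z_power_twist_fixed:
  assumes y: "y \<in> cyc_rat" "y \<noteq> 0"
    and S: "\<And>s. s \<in> S \<Longrightarrow> \<not> p dvd s" "\<And>s. s \<in> S \<Longrightarrow> [s ^ f = 1] (mod n)" and f: "f dvd p - 1"
    and fix_up: "\<And>s. s \<in> S \<Longrightarrow> \<exists>c. galois s y = z ^ c * y"
  shows "\<exists>j. \<forall>s\<in>S. galois s (y * z ^ j) = y * z ^ j"
proof (cases "\<forall>s\<in>S. [s = 1] (mod p)")
  case True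
  have "galois s (y * z ^ 0) = y * z ^ 0" if "s \<in> S" for s
  proof -
    have "[s = 1] (mod n)" using eq_1_if_power_dvd_p_minus_1 True S(2) f that by blast
    then show ?thesis using galois_cong galois_one y(1) by simp
  qed
  then show ?thesis by blast
next
  case False
  then obtain t where t: "t \<in> S" "\<not> [t = 1] (mod p)" by blast
  have pt: "\<not> p dvd t" using S(1) t by blast
  then have t0: "t > 0" by (auto intro: gr0I)
  then have "[t - 1 + 1 = t] (mod p)" by simp
  then have pt1: "\<not> p dvd t - 1"
    using t(2) by (metis add_0 cong_0_iff cong_add_rcancel_0_nat cong_sym cong_trans cong_add cong_refl)
  then have cop: "coprime (t - 1) n" by (simp add: coprime_n_iff)
  obtain c where c: "galois t y = z ^ c * y" using fix_up[OF t(1)] by blast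
  \<comment> \<open>In natural numbers \<open>(n - 1) * c\<close> stands for \<open>- c\<close>
    modulo \<open>n\<close>.\<close>
  obtain j where j: "[(t - 1) * j = (n - 1) * c] (mod n)"
    using cong_solve[OF cop] by blast
  define y' where "y' = y * z ^ j"
  have y': "y' \<in> cyc_rat" "y' \<noteq> 0" using y by (simp_all add: y'_def)
  have gt: "galois t y' = y'"
  proof -
    have "[c + t * j = j] (mod n)"
    proof -
      have "[c + (t - 1) * j + j = c + (n - 1) * c + j] (mod n)"
        using j by (intro cong_add cong_refl)
      moreover have "c + (t - 1) * j + j = c + t * j"
        using t0 by (metis add.assoc Suc_pred' add.commute mult_Suc Suc_eq_plus1)
      moreover have "c + (n - 1) * c + j = j + n * c"
        using n_pos by (metis add.commute Suc_pred' mult_Suc Suc_eq_plus1)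
      moreover have "[j + n * c = j] (mod n)" by (simp add: cong_def)
      ultimately show ?thesis by (metis cong_trans)
    qed
    then have "z ^ (c + t * j) = z ^ j" by (simp add: z_power_eq_iff)
    then show ?thesis using pt y by (simp add: y'_def galois_mult galois_z_power c power_add)
  qed
  have "galois s y' = y'" if s: "s \<in> S" for s
  proof -
    have ps: "\<not> p dvd s" using S(1) s by blast
    obtain d where d: "galois s y = z ^ d * y" using fix_up[OF s] by blast
    define k where "k = d + s * j + (n - 1) * j"
    have "z ^ ((n - 1) * j) * z ^ j = 1"
    proof -
      have "(n - 1) * j + j = n * j" using n_pos by (metis add.commute Suc_pred' mult_Suc Suc_eq_plus1)
      then have "z ^ ((n - 1) * j) * z ^ j = z ^ (n * j)" by (metis power_add)
      then show ?thesis by (simp add: power_mult)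
    qed
    then have k: "galois s y' = z ^ k * y'"
      using ps y by (simp add: y'_def k_def galois_mult galois_z_power d power_add mult_ac)
    \<comment> \<open>Applying \<open>t\<close> to \<open>z ^ k * y'\<close> must leave it
      unchanged, so \<open>n\<close> divides \<open>(t - 1) * k\<close> and hence
      \<open>k\<close>.\<close>
    have "galois t (galois s y') = galois s (galois t y')"
      using pt ps y' by (simp add: cyc_rat_galois mult.commute)
    then have "z ^ (t * k) * y' = z ^ k * y'"
      using pt y' by (simp add: gt k galois_mult galois_z_power)
    then have "[t * k = k] (mod n)" using y' by (simp add: z_power_eq_iff)
    then have "[(t - 1) * k + k = 0 + k] (mod n)"
      using t0 by (metis add.commute Suc_pred' mult_Suc add_0 Suc_eq_plus1)
    then have "[(t - 1) * k = 0] (mod n)" using cong_add_rcancel_nat by blast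
    then have "n dvd k" using cop by (simp add: cong_0_iff coprime_commute coprime_dvd_mult_right_iff)
    then show ?thesis using k by (simp add: z_power_eq_1_iff[THEN iffD2])
  qed
  then show ?thesis unfolding y'_def by blast
qed

text \<open>
  The Galois group of the cyclotomic field is cyclic, so an element of order dividing \<open>ord p q\<close>
  is a power of the Frobenius substitution at \<open>q\<close>.
\<close>

lemma exists_z_power_twist_fixed_by_subgroup:
  assumes y: "y \<in> cyc_int" "y * cnj y = of_nat N" and N: "N > 1" "\<not> p dvd N"
    and S: "S \<subseteq> {..<n}" "\<And>s. s \<in> S \<Longrightarrow> \<not> p dvd s"
      "\<And>s t. s \<in> S \<Longrightarrow> t \<in> S \<Longrightarrow> s * t mod n \<in> S"
    and f: "\<And>q. q \<in> prime_factors N \<Longrightarrow> card S dvd ord p q"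
  shows "\<exists>j. \<forall>s\<in>S. galois s (y * z ^ j) = y * z ^ j"
proof -
  have n1: "n > 1" using p_gt_2 p_dvd_n n_pos by (metis dvd_imp_le less_le_trans one_less_numeral_iff semiring_norm(76) less_trans)
  have sf: "[s ^ card S = 1] (mod n)" if "s \<in> S" for s
    using closed_residues_power_card[OF S(1) _ S(3) that] S(2) by (simp add: coprime_n_iff)
  have pq: "\<not> p dvd q" if "q \<in> prime_factors N" for q
    using that N(2) by (metis in_prime_factors_iff prime_p primes_dvd_imp_eq)
  obtain g where g: "residue_primroot n g"
    using residue_primroot_odd_prime_power_exists[OF prime_p] p_gt_2 prime_p r_pos
    by (metis n_def prime_odd_nat)
  have y0: "y \<noteq> 0" using y(2) N(1) by auto
  show ?thesis
  proof (rule exists_z_power_twist_fixed[OF cyc_int_subset_cyc_rat[OF y(1)] y0 S(2) sf])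
    obtain q where q: "q \<in> prime_factors N"
      using N(1) by (metis prime_factor_nat in_prime_factors_iff less_irrefl not_one_less_zero)
    have "[q ^ (p - 1) = 1] (mod p)" using fermat_theorem prime_p pq[OF q] by blast
    then have "ord p q dvd p - 1" by (simp only: ord_divides dvd_refl)
    then show "card S dvd p - 1" using f[OF q] dvd_trans by blast
    fix s assume s: "s \<in> S"
    have "\<exists>e. [s = q ^ e] (mod n)" if q: "q \<in> prime_factors N" for q
    proof (rule cong_power_of_power_eq_1[OF g n1])
      show "coprime q n" "coprime s n" using pq[OF q] S(2)[OF s] by (simp_all add: coprime_n_iff)
      \<comment> \<open>Orders only grow from modulus \<open>p\<close> to modulus \<open>n\<close>:
        \<open>card S\<close> divides \<open>ord p q\<close>, which divides
        \<open>ord n q\<close>.\<close>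
      have "[q ^ ord n q = 1] (mod n)" by (simp only: ord_divides dvd_refl)
      then have "[q ^ ord n q = 1] (mod p)" using p_dvd_n cong_dvd_modulus_nat by blast
      then have "ord p q dvd ord n q" by (simp only: ord_divides dvd_refl)
      then show "[s ^ ord n q = 1] (mod n)"
        using sf[OF s] f[OF q] by (meson dvd_trans ord_divides)
    qed
    then show "\<exists>c. galois s y = z ^ c * y"
      using galois_eq_z_power_mult[OF y _ N(2) S(2)[OF s]] N(1) by simp
  qed
qed

end

subsection \<open>Subfields of the cyclotomic field\<close>

lemma carrier_complex_field [simp]: "carrier complex_field = UNIV"
  and mult_complex_field [simp]: "x \<otimes>\<^bsub>complex_field\<^esub> y = x * y"
  and add_complex_field [simp]: "x \<oplus>\<^bsub>complex_field\<^esub> y = x + y"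
  and one_complex_field [simp]: "\<one>\<^bsub>complex_field\<^esub> = 1"
  and zero_complex_field [simp]: "\<zero>\<^bsub>complex_field\<^esub> = 0"
  by (simp_all add: ring_of_type_algebra_def)

lemma a_inv_complex_field [simp]: "\<ominus>\<^bsub>complex_field\<^esub> x = - x"
proof -
  interpret C: ring complex_field by (rule ring_from_type_algebra)
  have "\<ominus>\<^bsub>complex_field\<^esub> x + x = 0" using C.l_neg[of x] by simp
  then show ?thesis by (simp add: eq_neg_iff_add_eq_0)
qed

lemma m_inv_complex_field [simp]:
  assumes "x \<noteq> 0"
  shows "inv\<^bsub>complex_field\<^esub> x = inverse x"
proof -
  interpret C: field complex_field by (rule field_from_type_algebra)
  have "x \<in> Units complex_field" using assms by (simp add: C.field_Units)
  then have "inv\<^bsub>complex_field\<^esub> x * x = 1" using C.Units_l_inv by fastforce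
  then show ?thesis using assms by (metis inverse_unique mult.commute)
qed

lemma subfield_complexD:
  assumes "subfield K complex_field"
  shows "0 \<in> K" "1 \<in> K" "x \<in> K \<Longrightarrow> y \<in> K \<Longrightarrow> x + y \<in> K" "x \<in> K \<Longrightarrow> y \<in> K \<Longrightarrow> x * y \<in> K"
    "x \<in> K \<Longrightarrow> - x \<in> K" "x \<in> K \<Longrightarrow> inverse x \<in> K"
    "x \<in> K \<Longrightarrow> y \<in> K \<Longrightarrow> x - y \<in> K" "of_int c \<in> K"
proof -
  interpret C: field complex_field by (rule field_from_type_algebra)
  note sub = subringE[OF subfieldE(1)[OF assms], simplified]
  show K: "0 \<in> K" "1 \<in> K" "x \<in> K \<Longrightarrow> y \<in> K \<Longrightarrow> x + y \<in> K" "x \<in> K \<Longrightarrow> y \<in> K \<Longrightarrow> x * y \<in> K"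
    "x \<in> K \<Longrightarrow> - x \<in> K" for x y using sub by blast+
  show "x \<in> K \<Longrightarrow> inverse x \<in> K"
    using C.subfield_m_inv(1)[OF assms, of x] K(1) by (cases "x = 0") auto
  show "x \<in> K \<Longrightarrow> y \<in> K \<Longrightarrow> x - y \<in> K"
    using K(3)[of x "- y"] K(5) by simp
  have nat: "of_nat i \<in> K" for i by (induction i) (simp_all add: K)
  show "of_int c \<in> K"
    by (cases c rule: int_cases2) (simp_all add: K nat)
qed

section \<open>Polynomials over a subfield, and its degree\<close>

definition polys_over :: "complex set \<Rightarrow> complex poly set" where
  "polys_over K = {P. \<forall>i. coeff P i \<in> K}"

lemma pCons_polys_over:
  assumes "subfield K complex_field"
  shows "pCons a P \<in> polys_over K \<longleftrightarrow> a \<in> K \<and> P \<in> polys_over K"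
proof
  assume *: "pCons a P \<in> polys_over K"
  then have "coeff (pCons a P) 0 \<in> K" "\<And>i. coeff (pCons a P) (Suc i) \<in> K"
    by (simp_all only: polys_over_def mem_Collect_eq)
  then show "a \<in> K \<and> P \<in> polys_over K" by (simp add: polys_over_def)
qed (auto simp: polys_over_def coeff_pCons split: nat.splits)

lemma polys_over_closed:
  assumes K: "subfield K complex_field"
  shows "0 \<in> polys_over K" "P \<in> polys_over K \<Longrightarrow> Q \<in> polys_over K \<Longrightarrow> P + Q \<in> polys_over K"
    "P \<in> polys_over K \<Longrightarrow> Q \<in> polys_over K \<Longrightarrow> P - Q \<in> polys_over K"
    "c \<in> K \<Longrightarrow> P \<in> polys_over K \<Longrightarrow> smult c P \<in> polys_over K"
    "c \<in> K \<Longrightarrow> monom c i \<in> polys_over K"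
    "map_poly of_int R \<in> polys_over K"
  using subfield_complexD[OF K] by (auto simp: polys_over_def coeff_map_poly)

text \<open>Division by a monic polynomial keeps the remainder over \<open>K\<close>: if
  \<open>R\<close> is the remainder of \<open>P\<close>, then \<open>pCons a R\<close> has degree at
  most that of \<open>M\<close>, and one multiple of \<open>M\<close> removes its top
  coefficient.\<close>

lemma polys_over_division:
  assumes K: "subfield K complex_field"
    and M: "M \<in> polys_over K" "lead_coeff M = 1" "degree M > 0" and P: "P \<in> polys_over K"
  shows "\<exists>Q R. P = M * Q + R \<and> R \<in> polys_over K \<and> degree R < degree M"
  using P
proof (induction P)
  case 0
  show ?case using M(3) polys_over_closed(1)[OF K] by (intro exI[of _ 0]) simp
next
  case (pCons a P)
  have a: "a \<in> K" "P \<in> polys_over K" using pCons.prems pCons_polys_over[OF K] by auto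
  obtain Q R where QR: "P = M * Q + R" "R \<in> polys_over K" "degree R < degree M"
    using pCons.IH a(2) by blast
  define c where "c = coeff (pCons a R) (degree M)"
  define R' where "R' = pCons a R - smult c M"
  have aR: "pCons a R \<in> polys_over K" using QR a pCons_polys_over[OF K] by blast
  then have c: "c \<in> K" by (simp add: c_def polys_over_def)
  have "coeff R' i = 0" if "i \<ge> degree M" for i
  proof (cases "i = degree M")
    case True
    then show ?thesis using M(2) by (simp add: R'_def c_def)
  next
    case False
    then have "i > degree M" using that by simp
    then show ?thesis using QR(3) by (simp add: R'_def coeff_pCons coeff_eq_0 split: nat.splits)
  qed
  then have "degree R' < degree M" using M(3) by (metis leading_coeff_0_iff degree_0 not_less)
  moreover have "R' \<in> polys_over K"
    unfolding R'_def by (intro polys_over_closed[OF K] aR c M)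
  moreover have "pCons a P = M * (pCons 0 Q + [:c:]) + R'"
    by (simp add: QR(1) R'_def algebra_simps)
  ultimately show ?case by blast
qed

text \<open>The flag of spans of \<open>1, w, \<dots>, w\<^sup>i\<^sup>-\<^sup>1\<close> computes the degree of \<open>K(w)\<close> over \<open>K\<close>.\<close>

lemma dimension_eq_degree_of_minimal_polynomial:
  assumes K: "subfield K complex_field" and dim: "ring.dimension complex_field f K L"
    and M: "M \<in> polys_over K" "lead_coeff M = 1" "degree M > 0" "poly M w = 0"
    and min: "\<And>P. P \<in> polys_over K \<Longrightarrow> P \<noteq> 0 \<Longrightarrow> poly P w = 0 \<Longrightarrow> degree M \<le> degree P"
    and L: "L = (\<lambda>P. poly P w) ` polys_over K"
  shows "f = degree M"
proof -
  interpret C: field complex_field by (rule field_from_type_algebra)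
  define E where "E i = (\<lambda>P. poly P w) ` {P \<in> polys_over K. \<forall>j\<ge>i. coeff P j = 0}" for i
  have dimE: "C.dimension i K (E i)" if "i \<le> degree M" for i
    using that
  proof (induction i)
    case 0
    have "{P \<in> polys_over K. \<forall>j\<ge>0. coeff P j = 0} = {0}"
      using polys_over_closed(1)[OF K] by (auto intro: poly_eqI)
    then have "E 0 = {0}" by (simp add: E_def)
    then show ?case using C.zero_dim by simp
  next
    case (Suc i)
    \<comment> \<open>Otherwise \<open>w\<close> would satisfy a monic relation over
      \<open>K\<close> of degree \<open>i\<close>, below the minimal degree.\<close>
    have "w ^ i \<notin> E i"
    proof
      assume "w ^ i \<in> E i"
      then obtain P where P: "P \<in> polys_over K" "\<And>j. j \<ge> i \<Longrightarrow> coeff P j = 0" "w ^ i = poly P w"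
        by (auto simp: E_def)
      define Q where "Q = monom 1 i - P"
      have "coeff Q i = 1" by (simp add: Q_def P)
      then have "Q \<noteq> 0" by auto
      moreover have "Q \<in> polys_over K"
        unfolding Q_def by (intro polys_over_closed[OF K] P subfield_complexD[OF K])
      moreover have "poly Q w = 0" by (simp add: Q_def P(3) poly_monom)
      ultimately have "degree M \<le> degree Q" using min by blast
      moreover have "degree Q \<le> i" by (rule degree_le) (simp add: Q_def P)
      ultimately show False using Suc.prems by simp
    qed
    moreover have "C.line_extension K (w ^ i) (E i) = E (Suc i)"
    proof (intro equalityI subsetI)
      fix u assume "u \<in> C.line_extension K (w ^ i) (E i)"
      then obtain k P where kP: "k \<in> K" "P \<in> polys_over K" "\<forall>j\<ge>i. coeff P j = 0"
        "u = k * w ^ i + poly P w"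
        by (auto simp: C.line_extension_mem_iff E_def)
      then show "u \<in> E (Suc i)"
        unfolding E_def
        by (intro image_eqI[of _ _ "monom k i + P"])
          (auto simp: poly_monom intro: polys_over_closed[OF K])
    next
      fix u assume "u \<in> E (Suc i)"
      then obtain P where P: "P \<in> polys_over K" "\<forall>j\<ge>Suc i. coeff P j = 0" "u = poly P w"
        by (auto simp: E_def)
      define Q where "Q = P - monom (coeff P i) i"
      have k: "coeff P i \<in> K" using P(1) by (simp add: polys_over_def)
      have "poly Q w \<in> E i"
        unfolding E_def
      proof (rule imageI, intro CollectI conjI allI impI)
        show "Q \<in> polys_over K" unfolding Q_def by (intro polys_over_closed[OF K] P(1) k)
        fix j assume "i \<le> j"
        then show "coeff Q j = 0" using P(2) by (cases "j = i") (simp_all add: Q_def)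
      qed
      moreover have "u = coeff P i * w ^ i + poly Q w" by (simp add: P(3) Q_def poly_monom)
      ultimately show "u \<in> C.line_extension K (w ^ i) (E i)"
        using k by (auto simp: C.line_extension_mem_iff)
    qed
    ultimately show ?case using C.Suc_dim[of "w ^ i" "E i" i K] Suc by simp
  qed
  have "E (degree M) = L"
  proof (intro equalityI subsetI)
    fix x assume "x \<in> L"
    then obtain P where P: "P \<in> polys_over K" "x = poly P w" by (auto simp: L)
    obtain Q R where QR: "P = M * Q + R" "R \<in> polys_over K" "degree R < degree M"
      using polys_over_division[OF K M(1,2,3) P(1)] by blast
    then show "x \<in> E (degree M)"
      using M(4) P(2) unfolding E_def by (intro image_eqI[of _ _ R]) (auto simp: coeff_eq_0)
  qed (auto simp: E_def L)
  then have "C.dimension (degree M) K L" using dimE[of "degree M"] by simp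
  from C.dimension_is_inj[OF K dim this] show ?thesis .
qed

section \<open>Galois correspondence for \<rat>(z)\<close>

context prime_power_cyclotomic
begin

text \<open>A Euclidean descent: pseudo-division of \<open>M\<close> by \<open>P\<close> replaces
  \<open>P\<close> by a remainder of smaller degree, until some multiple of \<open>ev P z\<close> is
  a nonzero integer.\<close>

lemma inverse_in_cyc_rat:
  assumes "x \<in> cyc_rat" "x \<noteq> 0"
  shows "inverse x \<in> cyc_rat"
proof -
  obtain M where M: "lead_coeff M = 1" "\<And>P. ev P z = 0 \<longleftrightarrow> M dvd P"
    using exists_monic_generator_of_evaluation_kernel[OF n_pos z_power_n] by blast
  have M0: "M \<noteq> 0" using M(1) by auto
  have Mz: "ev M z = 0" using M(2)[of M] by simp
  have norm: "\<exists>Q e. e \<noteq> 0 \<and> ev P z * ev Q z = of_int e"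
    if "ev P z \<noteq> 0" "degree P < degree M" for P
    using that
  proof (induction "degree P" arbitrary: P rule: less_induct)
    case less
    have P0: "P \<noteq> 0" using less.prems by auto
    define R where "R = pseudo_mod M P"
    obtain c Q where c: "c \<noteq> 0" "smult c M = P * Q + R"
      using pseudo_mod(1)[OF P0, of M] by (auto simp: R_def)
    have R: "R = 0 \<or> degree R < degree P"
      using pseudo_mod(2)[OF P0, of M] by (auto simp: R_def)
    have "ev (smult c M) z = ev (P * Q + R) z" by (simp only: c)
    then have PQ: "ev P z * ev Q z = - ev R z" using Mz by (simp add: eq_neg_iff_add_eq_0)
    show ?case
    proof (cases "ev R z = 0")
      case False
      then have "degree R < degree P" using R by auto
      then obtain Q' e where "e \<noteq> 0" "ev R z * ev Q' z = of_int e"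
        using less.hyps[of R] less.prems False by auto
      then have "ev P z * ev (- (Q * Q')) z = of_int e"
        using PQ by (simp flip: mult.assoc)
      then show ?thesis using \<open>e \<noteq> 0\<close> by blast
    next
      case True
      \<comment> \<open>The degree of \<open>R\<close> is too small for a nonzero multiple of
        \<open>M\<close>. Then \<open>M\<close> divides \<open>Q\<close>, and comparing degrees
        leaves \<open>P\<close> constant.\<close>
      have "R = 0"
      proof (rule ccontr)
        assume "R \<noteq> 0"
        then have "degree M \<le> degree R" using True M(2) dvd_imp_degree_le by blast
        then show False using R \<open>R \<noteq> 0\<close> less.prems by simp
      qed
      then have cM: "smult c M = P * Q" using c by simp
      have "ev Q z = 0" using PQ True less.prems by simp
      then have "M dvd Q" using M(2) by blast
      moreover have "Q \<noteq> 0" using cM c(1) M0 by auto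
      ultimately have "degree M \<le> degree Q" by (rule dvd_imp_degree_le)
      moreover have "degree M = degree P + degree Q"
        using cM c(1) P0 \<open>Q \<noteq> 0\<close> by (metis degree_smult_eq degree_mult_eq)
      ultimately have "degree P = 0" by simp
      then obtain e where e: "P = [:e:]" by (rule degree_eq_zeroE)
      then show ?thesis using P0 by (intro exI[of _ 1] exI[of _ e]) simp
    qed
  qed
  obtain d P where d: "d \<noteq> 0" "of_int d * x = ev P z" using assms(1) by (rule cyc_ratE)
  obtain Q S where QS: "pseudo_divmod P M = (Q, S)" by force
  have PQS: "P = M * Q + S" and S: "S = 0 \<or> degree S < degree M"
    using pseudo_divmod[OF M0 QS] M(1) by simp_all
  have eS: "of_int d * x = ev S z" using PQS Mz d by simp
  then have Sz: "ev S z \<noteq> 0" using d assms(2) by auto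
  then have "degree S < degree M" using S by auto
  then obtain T e where e: "e \<noteq> 0" "ev S z * ev T z = of_int e" using norm Sz by blast
  then have "(of_int d * x) * ev T z = of_int e" by (simp only: eS)
  then have "x * (of_int d * ev T z) = of_int e" by (simp only: mult_ac)
  then have "of_int e * inverse x = of_int d * ev T z"
    using assms(2) by (metis mult.commute nonzero_mult_div_cancel_left divide_inverse)
  then have "of_int e * inverse x = ev (smult d T) z" by simp
  then show ?thesis using e(1) by (rule cyc_ratI[rotated])
qed

lemma cyclotomic_field_eq: "cyclotomic_field n = cyc_rat"
proof
  have Rats: "x \<in> cyc_rat" if "x \<in> \<rat>" for x
  proof -
    from that obtain a b where "b > 0" "x = of_int a / of_int b" by (rule Rats_cases')
    then show ?thesis by (intro cyc_ratI[of b _ "[:a:]"]) simp_all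
  qed
  show "cyclotomic_field n \<subseteq> cyc_rat"
  proof
    fix x assume "x \<in> cyclotomic_field n"
    then show "x \<in> cyc_rat" unfolding cyclotomic_field_def
      by (induction rule: generate_field.induct)
        (auto simp: Rats inverse_in_cyc_rat simp flip: z_def)
  qed
  interpret C: field complex_field by (rule field_from_type_algebra)
  have sub: "subfield (cyclotomic_field n) complex_field"
    unfolding cyclotomic_field_def by (rule C.generate_field_is_subfield) simp
  note F = subfield_complexD[OF sub]
  have z: "z \<in> cyclotomic_field n"
    unfolding cyclotomic_field_def z_def by (rule generate_field.incl) simp
  have ev: "ev P z \<in> cyclotomic_field n" for P
    by (induction P) (simp_all add: F z)
  show "cyc_rat \<subseteq> cyclotomic_field n"
  proof
    fix x assume "x \<in> cyc_rat"
    then obtain d P where d: "d \<noteq> 0" "of_int d * x = ev P z" by (rule cyc_ratE)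
    then have "x = inverse (of_int d) * ev P z" by (simp flip: d(2))
    then show "x \<in> cyclotomic_field n" by (simp add: F ev)
  qed
qed

lemma galois_poly:
  assumes K: "subfield K complex_field" "K \<subseteq> cyc_rat" and s: "\<not> p dvd s"
    and fixed: "\<And>k. k \<in> K \<Longrightarrow> galois s k = k" and x: "x \<in> cyc_rat" and P: "P \<in> polys_over K"
  shows "poly P x \<in> cyc_rat \<and> galois s (poly P x) = poly P (galois s x)"
  using P
proof (induction P)
  case 0
  then show ?case using s by simp
next
  case (pCons a P)
  then have a: "a \<in> K" "P \<in> polys_over K" using pCons_polys_over[OF K(1)] by auto
  then have IH: "poly P x \<in> cyc_rat" "galois s (poly P x) = poly P (galois s x)"
    using pCons.IH by auto
  have "a \<in> cyc_rat" using a K by blast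
  then show ?case using IH x s a fixed by (simp add: galois_add galois_mult)
qed

text \<open>The minimal polynomial \<open>M\<close> of \<open>z\<close> over \<open>K\<close> has
  degree \<open>f\<close> and splits into distinct powers of \<open>z\<close>. Their exponents are
  exactly the residues that act trivially on \<open>K\<close>, which gives the cardinality.\<close>

lemma exists_fixing_residues:
  assumes K: "subfield_of_degree K (cyclotomic_field n) f"
  shows "\<exists>S \<subseteq> {..<n}. card S = f \<and> (\<forall>s\<in>S. \<not> p dvd s) \<and> (\<forall>s\<in>S. \<forall>t\<in>S. s * t mod n \<in> S) \<and>
    (\<forall>x\<in>cyc_rat. (\<forall>s\<in>S. galois s x = x) \<longrightarrow> x \<in> K)"
proof -
  have sf: "subfield K complex_field" and KL: "K \<subseteq> cyc_rat"
    and dim: "ring.dimension complex_field f K cyc_rat"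
    using K by (simp_all add: subfield_of_degree_def cyclotomic_field_eq)
  note F = subfield_complexD[OF sf]
  define U where "U = (monom 1 n - 1 :: complex poly)"
  have coeffU: "coeff U n = 1" using n_pos by (simp add: U_def)
  then have U0: "U \<noteq> 0" by auto
  have "monom 1 n - monom 1 0 \<in> polys_over K" by (intro polys_over_closed[OF sf] F)
  then have U: "U \<in> polys_over K" "poly U z = 0" by (simp_all add: U_def poly_monom monom_0 one_pCons)
  obtain M0 where M0: "M0 \<in> polys_over K" "M0 \<noteq> 0" "poly M0 z = 0"
    and min: "\<And>P. P \<in> polys_over K \<Longrightarrow> P \<noteq> 0 \<Longrightarrow> poly P z = 0 \<Longrightarrow> degree M0 \<le> degree P"
    using ex_has_least_nat[of "\<lambda>P. P \<in> polys_over K \<and> P \<noteq> 0 \<and> poly P z = 0" U degree] U U0 by blast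
  define M where "M = smult (inverse (lead_coeff M0)) M0"
  have lM0: "lead_coeff M0 \<noteq> 0" using M0(2) by simp
  have "lead_coeff M0 \<in> K" using M0(1) by (simp add: polys_over_def)
  then have M: "M \<in> polys_over K" "lead_coeff M = 1" "poly M z = 0" "degree M = degree M0"
    using lM0 M0 by (auto simp: M_def intro: polys_over_closed[OF sf] F)
  have degM: "degree M > 0"
  proof (rule ccontr)
    assume "\<not> degree M > 0"
    then obtain c where "M = [:c:]" by (meson degree_eq_zeroE gr0I)
    then show False using M(2,3) by simp
  qed
  have dvd: "M dvd P" if P: "P \<in> polys_over K" "poly P z = 0" for P
  proof -
    obtain Q R where QR: "P = M * Q + R" "R \<in> polys_over K" "degree R < degree M"
      using polys_over_division[OF sf M(1,2) degM P(1)] by blast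
    then have "poly R z = 0" using P(2) M(3) by simp
    then have "R = 0" using min[of R] QR M(4) by (metis not_less)
    then show ?thesis using QR by simp
  qed
  have ev_polys: "x = poly P z \<and> P \<in> polys_over K"
    if "e \<noteq> 0" "of_int e * x = ev G z" "P = smult (inverse (of_int e)) (map_poly of_int G)" for e x G P
  proof -
    have "x = inverse (of_int e) * ev G z" using that(1) by (simp flip: that(2))
    then show ?thesis using that(3) by (auto simp: ev_def intro: polys_over_closed[OF sf] F)
  qed
  have img: "cyc_rat = (\<lambda>P. poly P z) ` polys_over K"
  proof (intro equalityI subsetI)
    fix x assume "x \<in> cyc_rat"
    then obtain e G where "e \<noteq> 0" "of_int e * x = ev G z" by (rule cyc_ratE)
    then show "x \<in> (\<lambda>P. poly P z) ` polys_over K" using ev_polys by blast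
  next
    fix x assume "x \<in> (\<lambda>P. poly P z) ` polys_over K"
    then obtain P where P: "P \<in> polys_over K" "x = poly P z" by blast
    have "poly P z \<in> cyc_rat" using P(1)
    proof (induction P)
      case (pCons a P)
      then show ?case using pCons_polys_over[OF sf] KL by auto
    qed simp
    then show "x \<in> cyc_rat" by (simp add: P)
  qed
  have f: "f = degree M"
    using dimension_eq_degree_of_minimal_polynomial[OF sf dim M(1,2) degM M(3) _ img] min M(4) by simp
  define S where "S = {s. s < n \<and> \<not> p dvd s \<and> (\<forall>k\<in>K. galois s k = k)}"
  have "bij_betw (\<lambda>s. z ^ s) S {w. poly M w = 0}"
  proof (rule bij_betw_imageI)
    show "inj_on (\<lambda>s. z ^ s) S"
      using roots_of_unity_bij by (rule inj_on_subset[OF bij_betw_imp_inj_on]) (auto simp: S_def)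
    show "(\<lambda>s. z ^ s) ` S = {w. poly M w = 0}"
    proof (intro equalityI subsetI)
      fix w assume "w \<in> (\<lambda>s. z ^ s) ` S"
      then obtain s where s: "s \<in> S" "w = z ^ s" by blast
      then have ps: "\<not> p dvd s" by (simp add: S_def)
      have "galois s (poly M z) = poly M (galois s z)"
        using galois_poly[OF sf KL ps _ cyc_rat_z M(1)] s(1) by (simp add: S_def)
      then show "w \<in> {w. poly M w = 0}" using s ps M(3) galois_z_power[of s 1] by simp
    next
      fix w assume "w \<in> {w. poly M w = 0}"
      then have w: "poly M w = 0" by simp
      have root: "poly P w = 0" if "P \<in> polys_over K" "poly P z = 0" for P
        using dvd[OF that] w by auto
      have "w ^ n = 1" using root[OF U] by (simp add: U_def poly_monom)
      then have "w \<in> (\<lambda>k. z ^ k) ` {..<n}" using roots_of_unity_bij by (auto simp: bij_betw_def)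
      then obtain s where s: "s < n" "w = z ^ s" by blast
      \<comment> \<open>If \<open>p\<close> divided \<open>s\<close>, then \<open>w ^ n'\<close>
        would be 1 and the cyclotomic polynomial would take the value \<open>p\<close> at
        \<open>w\<close>; but it vanishes at \<open>z\<close>, hence at every root of
        \<open>M\<close>.\<close>
      have ps: "\<not> p dvd s"
      proof
        assume "p dvd s"
        define \<Phi> where "\<Phi> = (\<Sum>l<p. monom 1 (n' * l) :: int poly)"
        have "ev \<Phi> z = 0" using sum_coset_zero[of 0] by (simp add: \<Phi>_def)
        then have "poly (map_poly of_int \<Phi>) w = 0"
          by (intro root polys_over_closed[OF sf]) (simp add: ev_def)
        then have "(\<Sum>l<p. w ^ (n' * l)) = 0" by (simp add: \<Phi>_def flip: ev_def)
        moreover have "w ^ (n' * l) = 1" for l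
        proof -
          have "n dvd s * (n' * l)" using \<open>p dvd s\<close> by (auto simp: n_eq)
          then show ?thesis by (simp add: s(2) z_power_eq_1_iff flip: power_mult)
        qed
        ultimately show False using p_pos by simp
      qed
      have "galois s k = k" if k: "k \<in> K" for k
      proof -
        have "k \<in> cyc_rat" using k KL by blast
        then obtain e G where e: "e \<noteq> 0" "of_int e * k = ev G z" by (rule cyc_ratE)
        \<comment> \<open>A representation of \<open>k\<close> is a relation for \<open>z\<close>
          over \<open>K\<close>, which the root \<open>w\<close> shares.\<close>
        have "poly (map_poly of_int G - [:of_int e * k:]) w = 0"
        proof (rule root)
          have "[:of_int e * k:] \<in> polys_over K"
            using polys_over_closed(5)[OF sf, of "of_int e * k" 0] F k by (simp add: monom_0)
          then show "map_poly of_int G - [:of_int e * k:] \<in> polys_over K"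
            by (intro polys_over_closed[OF sf])
          show "poly (map_poly of_int G - [:of_int e * k:]) z = 0" by (simp add: e(2) ev_def)
        qed
        then have "ev G (z ^ s) = of_int e * k" by (simp add: ev_def s)
        then show ?thesis using galois_eq[OF ps e] e(1) by simp
      qed
      then show "w \<in> (\<lambda>s. z ^ s) ` S" using s ps by (auto simp: S_def)
    qed
  qed
  then have cardS: "card S = card {w. poly M w = 0}" by (rule bij_betw_same_card)
  have cardM: "card {w. poly M w = 0} = degree M"
  proof (rule antisym)
    have "M \<noteq> 0" using degM by auto
    then show "card {w. poly M w = 0} \<le> degree M" by (rule card_poly_roots_bound)
    obtain Q where Q: "U = M * Q" using dvd[OF U] by blast
    have "Q \<noteq> 0" using Q U0 by auto
    \<comment> \<open>\<open>U\<close> has \<open>n\<close> distinct roots and degree at most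
      \<open>n\<close>, so neither factor \<open>M\<close> nor \<open>Q\<close> can have fewer roots
      than its degree.\<close>
    have "{w. w ^ n = 1} = {w. poly M w = 0} \<union> {w. poly Q w = 0}"
    proof -
      have "w ^ n = 1 \<longleftrightarrow> poly U w = 0" for w by (simp add: U_def poly_monom)
      then show ?thesis by (auto simp: Q)
    qed
    then have "n \<le> card {w. poly M w = 0} + card {w. poly Q w = 0}"
      using bij_betw_same_card[OF roots_of_unity_bij] card_Un_le[of "{w. poly M w = 0}" "{w. poly Q w = 0}"]
      by simp
    moreover have "card {w. poly Q w = 0} \<le> degree Q" using \<open>Q \<noteq> 0\<close> by (rule card_poly_roots_bound)
    moreover have "degree M + degree Q \<le> n"
    proof -
      have "degree U \<le> n"
        unfolding U_def by (rule degree_diff_le) (simp_all add: degree_monom_le)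
      then show ?thesis using Q \<open>M \<noteq> 0\<close> \<open>Q \<noteq> 0\<close> by (simp add: degree_mult_eq)
    qed
    ultimately show "degree M \<le> card {w. poly M w = 0}" by linarith
  qed
  have closed: "s * t mod n \<in> S" if st: "s \<in> S" "t \<in> S" for s t
  proof -
    have ps: "\<not> p dvd s" "\<not> p dvd t" using st by (simp_all add: S_def)
    have cong: "[s * t mod n = s * t] (mod n)" by (simp add: cong_def)
    have "\<not> p dvd s * t mod n"
      using p_dvd_cong[OF cong] ps prime_p by (simp add: prime_dvd_mult_iff)
    moreover have "galois (s * t mod n) k = k" if k: "k \<in> K" for k
    proof -
      have "galois (s * t mod n) k = galois s (galois t k)"
        using galois_cong[OF cong] cyc_rat_galois(2)[OF ps(2) _ ps(1)] k KL by auto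
      then show ?thesis using st k by (simp add: S_def)
    qed
    ultimately show ?thesis using n_pos by (simp add: S_def)
  qed
  have fixed: "x \<in> K" if x: "x \<in> cyc_rat" "\<forall>s\<in>S. galois s x = x" for x
  proof -
    obtain P where P: "P \<in> polys_over K" "x = poly P z" using x(1) img by blast
    obtain Q R where QR: "P = M * Q + R" "R \<in> polys_over K" "degree R < degree M"
      using polys_over_division[OF sf M(1,2) degM P(1)] by blast
    have xR: "x = poly R z" using P QR M(3) by simp
    \<comment> \<open>\<open>T\<close> vanishes at all roots of \<open>M\<close>, more than its
      degree allows. So \<open>R\<close> is constant and \<open>x\<close> is one of its
      coefficients.\<close>
    define T where "T = R - [:x:]"
    have "{w. poly M w = 0} \<subseteq> {w. poly T w = 0}"
    proof
      fix w assume "w \<in> {w. poly M w = 0}"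
      then obtain s where s: "s \<in> S" "w = z ^ s"
        using \<open>bij_betw (\<lambda>s. z ^ s) S {w. poly M w = 0}\<close> by (auto simp: bij_betw_def)
      then have ps: "\<not> p dvd s" by (simp add: S_def)
      have "galois s (poly R z) = poly R (galois s z)"
        using galois_poly[OF sf KL ps _ cyc_rat_z QR(2)] s(1) by (simp add: S_def)
      then have "poly R w = x" using x(2) s ps xR galois_z_power[of s 1] by simp
      then show "w \<in> {w. poly T w = 0}" by (simp add: T_def)
    qed
    have "T = 0"
    proof (rule ccontr)
      assume "T \<noteq> 0"
      then have "degree M \<le> degree T"
        using card_mono[OF poly_roots_finite \<open>{w. poly M w = 0} \<subseteq> {w. poly T w = 0}\<close>]
          card_poly_roots_bound[of T] cardM by simp
      also have "degree T \<le> max (degree R) (degree [:x:])" unfolding T_def by (rule degree_diff_le_max)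
      finally show False using QR(3) degM by simp
    qed
    then have "R = [:x:]" by (simp add: T_def)
    then have "coeff R 0 = x" by simp
    then show "x \<in> K" using QR(2) by (auto simp: polys_over_def)
  qed
  show ?thesis
    by (intro exI[of _ S] conjI) (use closed fixed cardS cardM f in \<open>auto simp: S_def\<close>)
qed

end

subsection \<open>Character sums of external difference families\<close>

lemma sum_mset_eq_sum_count:
  fixes h :: "'a \<Rightarrow> 'b::comm_semiring_1"
  assumes "finite A" "set_mset M \<subseteq> A"
  shows "(\<Sum>x\<in>#M. h x) = (\<Sum>x\<in>A. of_nat (count M x) * h x)"
  using assms(2)
proof (induction M)
  case (add x M)
  have "(\<Sum>y\<in>A. of_nat (count (add_mset x M) y) * h y)
      = (\<Sum>y\<in>A. of_nat (count M y) * h y + (if x = y then h y else 0))"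
    by (intro sum.cong refl) (simp add: algebra_simps)
  also have "\<dots> = (\<Sum>y\<in>A. of_nat (count M y) * h y) + h x"
    using add.prems assms(1) by (simp add: sum.distrib)
  finally show ?case using add by (simp add: add.commute)
qed simp

section \<open>Characters of finite abelian groups\<close>

locale finite_group_character = comm_group G for G :: "('g, 'b) monoid_scheme" (structure) +
  fixes \<chi> :: "'g \<Rightarrow> complex"
  assumes finite_carrier: "finite (carrier G)" and character: "is_character G \<chi>"
begin

lemma chi_mult: "x \<in> carrier G \<Longrightarrow> y \<in> carrier G \<Longrightarrow> \<chi> (x \<otimes> y) = \<chi> x * \<chi> y"
  using character by (auto simp: is_character_def hom_def units_of_def)

lemma chi_nonzero: "x \<in> carrier G \<Longrightarrow> \<chi> x \<noteq> 0"
proof -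
  interpret C: field complex_field by (rule field_from_type_algebra)
  assume "x \<in> carrier G"
  then have "\<chi> x \<in> Units complex_field"
    using character by (auto simp: is_character_def hom_def units_of_def)
  then show ?thesis by (simp add: C.field_Units)
qed

lemma chi_one: "\<chi> \<one> = 1"
  using chi_mult[of \<one> \<one>] chi_nonzero[of \<one>] by simp

lemma chi_pow: "x \<in> carrier G \<Longrightarrow> \<chi> (x [^] (i::nat)) = \<chi> x ^ i"
  by (induction i) (simp_all add: chi_one chi_mult)

lemma character_order: "character_order G \<chi> > 0"
  "x \<in> carrier G \<Longrightarrow> \<chi> x ^ character_order G \<chi> = 1"
proof -
  have "\<exists>i>0. \<forall>x\<in>carrier G. \<chi> x ^ i = 1"
  proof (intro exI conjI ballI)
    show "Coset.order G > 0" using finite_carrier by (simp add: order_gt_0_iff_finite)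
    fix x assume x: "x \<in> carrier G"
    then show "\<chi> x ^ Coset.order G = 1" using chi_pow[of x "Coset.order G"] by (simp add: pow_order_eq_1 chi_one)
  qed
  from LeastI_ex[OF this]
  show "character_order G \<chi> > 0" "x \<in> carrier G \<Longrightarrow> \<chi> x ^ character_order G \<chi> = 1"
    by (simp_all add: character_order_def)
qed

lemma norm_chi: "x \<in> carrier G \<Longrightarrow> cmod (\<chi> x) = 1"
  using character_order by (metis norm_ge_zero norm_one norm_power power_eq_1_iff less_irrefl)

lemma chi_inv: "x \<in> carrier G \<Longrightarrow> \<chi> (inv x) = cnj (\<chi> x)"
proof -
  assume x: "x \<in> carrier G"
  have "\<chi> x * \<chi> (inv x) = 1" using chi_mult[of x "inv x"] x by (simp add: chi_one)
  moreover have "\<chi> x * cnj (\<chi> x) = 1" using complex_norm_square[of "\<chi> x"] norm_chi[OF x] by simp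
  ultimately show ?thesis by (metis inverse_unique)
qed

lemma sum_nonprincipal:
  assumes "nonprincipal G \<chi>"
  shows "(\<Sum>x\<in>carrier G. \<chi> x) = 0"
proof -
  obtain y where y: "y \<in> carrier G" "\<chi> y \<noteq> 1" using assms by (auto simp: nonprincipal_def)
  have "bij_betw (\<lambda>x. y \<otimes> x) (carrier G) (carrier G)"
    using y inj_on_cmult surj_const_mult by (simp add: bij_betw_def)
  then have "(\<Sum>x\<in>carrier G. \<chi> x) = (\<Sum>x\<in>carrier G. \<chi> (y \<otimes> x))"
    by (rule sum.reindex_bij_betw[symmetric])
  also have "\<dots> = \<chi> y * (\<Sum>x\<in>carrier G. \<chi> x)"
    by (simp add: sum_distrib_left chi_mult y)
  finally show ?thesis using y(2) by simp
qed

text \<open>The sum of \<open>\<chi>\<close> over the external differences is computed twice: by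
  multiplicity it is \<open>lam\<close> times the sum over non-identity elements, which is -1; over
  the triples it factors because \<open>\<chi>\<close> turns inverses into conjugates.\<close>

lemma SEDF_char_sum:
  assumes sedf: "SEDF G v m k lam D" and np: "nonprincipal G \<chi>" and j: "j \<in> {1..m}"
  shows "((\<Sum>i=1..m. char_sum \<chi> (D i)) - char_sum \<chi> (D j)) * cnj (char_sum \<chi> (D j)) = - of_nat lam"
proof -
  have D: "D i \<subseteq> carrier G" "finite (D i)" if "i \<in> {1..m}" for i
  proof -
    show "D i \<subseteq> carrier G" using sedf that by (simp add: SEDF_def)
    then show "finite (D i)" using finite_carrier finite_subset by blast
  qed
  define M where "M = ext_differences G m D j"
  have cnt: "count M g = lam" if "g \<in> carrier G - {\<one>}" for g
    using sedf that j by (simp add: SEDF_def M_def)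
  have one: "\<one> \<notin># M" using sedf j by (simp add: SEDF_def M_def)
  have fin: "finite (SIGMA l : {1..m} - {j}. D l \<times> D j)" using D j by auto
  have sub: "set_mset M \<subseteq> carrier G - {\<one>}"
  proof
    fix g assume g: "g \<in># M"
    have "set_mset M = (\<lambda>(l, x, y). x \<otimes> inv y) ` (SIGMA l : {1..m} - {j}. D l \<times> D j)"
      unfolding M_def ext_differences_def set_image_mset finite_set_mset_mset_set[OF fin] ..
    then obtain l x y where "l \<in> {1..m}" "x \<in> D l" "y \<in> D j" "g = x \<otimes> inv y"
      using g by (fastforce elim!: imageE)
    then have "g \<in> carrier G" using D j by blast
    then show "g \<in> carrier G - {\<one>}" using g one by blast
  qed
  have "(\<Sum>g\<in>#M. \<chi> g) = (\<Sum>g\<in>carrier G - {\<one>}. of_nat (count M g) * \<chi> g)"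
    using sub finite_carrier by (intro sum_mset_eq_sum_count) auto
  also have "\<dots> = of_nat lam * (\<Sum>g\<in>carrier G - {\<one>}. \<chi> g)"
    by (simp add: sum_distrib_left cnt)
  also have "(\<Sum>g\<in>carrier G - {\<one>}. \<chi> g) = -1"
    using sum_nonprincipal[OF np] finite_carrier by (simp add: sum_diff1 chi_one)
  finally have "(\<Sum>g\<in>#M. \<chi> g) = - of_nat lam" by simp
  moreover have "(\<Sum>g\<in>#M. \<chi> g)
      = (\<Sum>(l, x, y)\<in>(SIGMA l : {1..m} - {j}. D l \<times> D j). \<chi> (x \<otimes> inv y))"
    by (simp add: M_def ext_differences_def sum_unfold_sum_mset image_mset.compositionality o_def case_prod_unfold)
  moreover have "\<dots> = (\<Sum>l\<in>{1..m} - {j}. \<Sum>x\<in>D l. \<Sum>y\<in>D j. \<chi> (x \<otimes> inv y))"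
  proof -
    have "(\<Sum>l\<in>{1..m} - {j}. \<Sum>x\<in>D l. \<Sum>y\<in>D j. \<chi> (x \<otimes> inv y))
        = (\<Sum>l\<in>{1..m} - {j}. \<Sum>(x, y)\<in>D l \<times> D j. \<chi> (x \<otimes> inv y))"
      by (simp only: sum.cartesian_product)
    also have "\<dots> = (\<Sum>(l, x, y)\<in>(SIGMA l : {1..m} - {j}. D l \<times> D j). \<chi> (x \<otimes> inv y))"
      using D j by (intro sum.Sigma) auto
    finally show ?thesis by simp
  qed
  moreover have "\<dots> = (\<Sum>l\<in>{1..m} - {j}. \<Sum>x\<in>D l. \<Sum>y\<in>D j. \<chi> x * cnj (\<chi> y))"
  proof (intro sum.cong refl)
    fix l x y assume "l \<in> {1..m} - {j}" "x \<in> D l" "y \<in> D j"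
    then have "x \<in> carrier G" "y \<in> carrier G" using D j by blast+
    then show "\<chi> (x \<otimes> inv y) = \<chi> x * cnj (\<chi> y)" by (simp add: chi_mult chi_inv)
  qed
  moreover have "\<dots> = (\<Sum>l\<in>{1..m} - {j}. char_sum \<chi> (D l)) * cnj (char_sum \<chi> (D j))"
    unfolding char_sum_def cnj_sum sum_distrib_right by (simp add: sum_distrib_left)
  moreover have "(\<Sum>l\<in>{1..m} - {j}. char_sum \<chi> (D l)) = (\<Sum>i=1..m. char_sum \<chi> (D i)) - char_sum \<chi> (D j)"
    using j by (simp add: sum_diff1)
  ultimately show ?thesis by metis
qed

end

text \<open>The relation says that \<open>x = t W\<close> for a real root \<open>t\<close> of \<open>t\<^sup>2 - t = l / \<bar>W\<bar>\<^sup>2\<close>.\<close>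

lemma real_multiple_of_sum:
  fixes W x :: complex and l \<rho> :: real
  assumes W: "W \<noteq> 0" and eq: "(W - x) * cnj x = - of_real l" and \<rho>: "\<rho> = sqrt (1 + 4 * l / (cmod W)\<^sup>2)"
    and l: "l \<ge> 0"
  shows "2 * x = of_real (1 + \<rho>) * W \<or> 2 * x = of_real (1 - \<rho>) * W"
proof -
  have c: "(cmod W)\<^sup>2 > 0" using W by simp
  \<comment> \<open>This is \<open>x / W\<close>, which is real because the hypothesis says that
    \<open>W * cnj x\<close> is \<open>(cmod x)\<^sup>2 - l\<close>.\<close>
  define t where "t = ((cmod x)\<^sup>2 - l) / (cmod W)\<^sup>2"
  have "W * cnj x = of_real ((cmod x)\<^sup>2 - l)"
    using eq by (simp add: algebra_simps complex_norm_square del: of_real_power)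
  then have "cnj (W * cnj x) = of_real ((cmod x)\<^sup>2 - l)" by (simp only: complex_cnj_complex_of_real)
  then have "W * (cnj W * x) = W * of_real ((cmod x)\<^sup>2 - l)" by simp
  then have "of_real ((cmod W)\<^sup>2) * x = of_real ((cmod x)\<^sup>2 - l) * W"
    by (simp only: complex_norm_square mult_ac)
  then have "x = of_real ((cmod x)\<^sup>2 - l) * W / of_real ((cmod W)\<^sup>2)"
    using c by (metis nonzero_mult_div_cancel_left of_real_eq_0_iff less_irrefl)
  then have xt: "x = of_real t * W" by (simp add: t_def)
  have "(cmod x)\<^sup>2 = t\<^sup>2 * (cmod W)\<^sup>2" by (simp add: xt norm_mult power_mult_distrib)
  then have "t * (cmod W)\<^sup>2 = t\<^sup>2 * (cmod W)\<^sup>2 - l" using c by (simp add: t_def)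
  then have "l / (cmod W)\<^sup>2 = t\<^sup>2 - t" using c by (simp add: field_simps)
  moreover have "(2 * t - 1)\<^sup>2 = 1 + 4 * (t\<^sup>2 - t)"
    by (simp add: power2_eq_square algebra_simps)
  ultimately have "1 + 4 * (l / (cmod W)\<^sup>2) = (2 * t - 1)\<^sup>2" by simp
  then have "1 + 4 * l / (cmod W)\<^sup>2 = (2 * t - 1)\<^sup>2" by simp
  then have "\<rho> = \<bar>2 * t - 1\<bar>" unfolding \<rho> by simp
  then have "2 * t = 1 + \<rho> \<or> 2 * t = 1 - \<rho>" by linarith
  then show ?thesis
  proof
    assume t: "2 * t = 1 + \<rho>"
    show ?thesis unfolding t[symmetric] by (simp add: xt)
  next
    assume t: "2 * t = 1 - \<rho>"
    show ?thesis unfolding t[symmetric] by (simp add: xt)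
  qed
qed

section \<open>Character values of the blocks and the subfield \<open>K\<close>\<close>

theorem theorem4p18:
  fixes G :: "('g, 'b) monoid_scheme"
    and D :: "nat \<Rightarrow> 'g set"
    and \<chi> :: "'g \<Rightarrow> complex"
    and v m k lam p r a b f :: nat
    and K :: "complex set"
  assumes "SEDF G v m k lam D"
    and "m \<ge> 3"
    and "Factorial_Ring.prime p" and "p > 2" and "p dvd v"
    and "is_character G \<chi>" and "nonprincipal G \<chi>"
    and "character_order G \<chi> = p ^ r"
    and "(\<Sum>i=1..m. char_sum \<chi> (D i)) \<noteq> 0"
    and "a > 0" and "b > 0" and "coprime a b"
    and "real b / real a = sqrt (1 + 4 * real lam / (cmod (char_sum \<chi> (\<Union>i\<in>{1..m}. D i)))\<^sup>2)"
    and "\<not> p dvd quot_number lam a b"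
    and "f = (GCD q\<in>prime_factors (quot_number lam a b). ord p q)"
    and "subfield_of_degree K (cyclotomic_field (p ^ r)) f"
  shows "\<exists>j::int. \<forall>i\<in>{1..m}.
           char_sum \<chi> (D i) * zeta (p ^ r) powi j \<in> K \<and>
           (char_sum \<chi> (D i) * cnj (char_sum \<chi> (D i))
              = of_real ((real a + real b) * real lam / (real b - real a)) \<or>
            char_sum \<chi> (D i) * cnj (char_sum \<chi> (D i))
              = of_real ((real b - real a) * real lam / (real b + real a)))"
proof -
  define W where "W = (\<Sum>i=1..m. char_sum \<chi> (D i))"
  note sedf = assms(1)
  have G: "comm_group G" "finite (carrier G)" using sedf by (simp_all add: SEDF_def)
  interpret finite_group_character G \<chi>
    using G assms(6) by (simp add: finite_group_character_def finite_group_character_axioms_def)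
  have fin: "finite (D i)" if "i \<in> {1..m}" for i
  proof -
    have "D i \<subseteq> carrier G" using sedf that by (simp add: SEDF_def)
    then show ?thesis using G(2) finite_subset by blast
  qed
  have WD: "char_sum \<chi> (\<Union>i\<in>{1..m}. D i) = W"
    unfolding W_def char_sum_def
    using sedf fin by (intro sum.UNION_disjoint) (auto simp: SEDF_def disjoint_family_on_def)
  have W0: "W \<noteq> 0" using assms(9) by (simp add: W_def)
  have r: "r > 0"
  proof (rule gr0I)
    assume "r = 0"
    then have "\<chi> x = 1" if "x \<in> carrier G" for x
      using character_order(2)[OF that] assms(8) by simp
    then show False using assms(7) by (auto simp: nonprincipal_def)
  qed
  interpret prime_power_cyclotomic p r
    using assms(3,4) r by unfold_locales
  have zn: "zeta (p ^ r) = z" by (simp add: z_def n_def)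
  \<comment> \<open>For \<open>lam = 0\<close> the quotient would be 0, a multiple of
    \<open>p\<close>.\<close>
  have lam: "lam > 0"
    using assms(14) by (intro gr0I) (simp add: quot_number_def)
  define N where "N = quot_number lam a b"
  define Y where "Y = W / of_nat a"
  have a0: "of_nat a \<noteq> (0::complex)" using assms(10) by simp
  have WY: "W = of_nat a * Y" using a0 by (simp add: Y_def)
  have chi_int: "\<chi> x \<in> cyc_int" if "x \<in> carrier G" for x
  proof -
    have "\<chi> x ^ n = 1" using character_order(2)[OF that] assms(8) by (simp add: n_def)
    then obtain i where "\<chi> x = z ^ i" using root_of_unity_is_z_power by blast
    then show ?thesis by simp
  qed
  have x_int: "char_sum \<chi> (D i) \<in> cyc_int" if "i \<in> {1..m}" for i
  proof -
    have "D i \<subseteq> carrier G" using sedf that by (simp add: SEDF_def)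
    then show ?thesis unfolding char_sum_def using chi_int by (intro cyc_int_sum) blast
  qed
  have W_int: "W \<in> cyc_int" unfolding W_def using x_int by (intro cyc_int_sum) auto
  have quot: "real b / real a = sqrt (1 + 4 * real lam / (cmod W)\<^sup>2)"
    using assms(13) by (simp only: WD)
  have x_eq: "2 * char_sum \<chi> (D i) = of_int (int a + int b) * Y \<or>
      2 * char_sum \<chi> (D i) = of_int (int a - int b) * Y" if i: "i \<in> {1..m}" for i
  proof -
    have "(W - char_sum \<chi> (D i)) * cnj (char_sum \<chi> (D i)) = - of_real (real lam)"
      using SEDF_char_sum[OF sedf assms(7) i] by (simp add: W_def)
    from real_multiple_of_sum[OF W0 this quot]
    have "2 * char_sum \<chi> (D i) = of_real (1 + real b / real a) * W \<or>
        2 * char_sum \<chi> (D i) = of_real (1 - real b / real a) * W" by simp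
    moreover have "of_real (1 + real b / real a) * W = of_int (int a + int b) * Y"
      "of_real (1 - real b / real a) * W = of_int (int a - int b) * Y"
      using a0 by (simp_all add: WY field_simps)
    ultimately show ?thesis by simp
  qed
  have normW: "(real b)\<^sup>2 * (cmod W)\<^sup>2 = (real a)\<^sup>2 * ((cmod W)\<^sup>2 + 4 * real lam)"
  proof -
    have "(real b / real a)\<^sup>2 = 1 + 4 * real lam / (cmod W)\<^sup>2" unfolding quot by simp
    then show ?thesis using W0 assms(10) by (simp add: field_simps power_divide)
  qed
  have normY: "((real b)\<^sup>2 - (real a)\<^sup>2) * (cmod Y)\<^sup>2 = 4 * real lam"
  proof -
    have "(cmod W)\<^sup>2 = (real a)\<^sup>2 * (cmod Y)\<^sup>2" by (simp add: WY norm_mult power_mult_distrib)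
    then have "(real a)\<^sup>2 * (((real b)\<^sup>2 - (real a)\<^sup>2) * (cmod Y)\<^sup>2) = (real a)\<^sup>2 * (4 * real lam)"
      using normW by (simp add: algebra_simps)
    then show ?thesis using assms(10) by simp
  qed
  have ab: "a < b"
  proof (rule ccontr)
    assume "\<not> a < b"
    then have "(real b)\<^sup>2 \<le> (real a)\<^sup>2" by (intro power_mono) simp_all
    then have "((real b)\<^sup>2 - (real a)\<^sup>2) * (cmod Y)\<^sup>2 \<le> 0" by (intro mult_nonpos_nonneg) simp_all
    then show False using normY lam by simp
  qed
  have Y_int: "Y \<in> cyc_int"
  proof -
    have "1 \<in> {1..m}" using assms(2) by simp
    then obtain c where c: "2 * char_sum \<chi> (D 1) = of_int c * Y" "c = int a + int b \<or> c = int a - int b"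
      using x_eq by blast
    have "coprime (int a) (int b)" using assms(12) by simp
    \<comment> \<open>Both \<open>a * Y = W\<close> and \<open>c * Y\<close> are in \<int>[z], so
      Bezout puts \<open>Y\<close> there.\<close>
    then have "coprime (int a) c" using c(2)
      by (metis coprime_iff_gcd_eq_1 gcd_add1 gcd_add2 gcd_diff1 gcd_diff2 gcd.commute)
    then obtain u w where uw: "u * int a + w * c = 1"
      by (metis bezout_int coprime_iff_gcd_eq_1)
    have "Y = of_int (u * int a + w * c) * Y" by (simp add: uw)
    also have "\<dots> = of_int u * W + of_int w * (2 * char_sum \<chi> (D 1))"
      unfolding c(1) WY by (simp add: algebra_simps)
    also have "\<dots> \<in> cyc_int"
      using W_int x_int[OF \<open>1 \<in> {1..m}\<close>] cyc_int_of_int[of 2]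
      by (intro cyc_int_add cyc_int_mult cyc_int_of_int) simp_all
    finally show ?thesis .
  qed
  have b2a2: "b\<^sup>2 - a\<^sup>2 > 0" "real (b\<^sup>2 - a\<^sup>2) = (real b)\<^sup>2 - (real a)\<^sup>2"
    using ab by (simp_all add: power_strict_mono of_nat_diff power_mono less_imp_le)
  \<comment> \<open>\<open>Y * cnj Y\<close> is a rational element of \<int>[z], hence an integer,
    so the division in \<open>quot_number\<close> is exact.\<close>
  have "b\<^sup>2 - a\<^sup>2 dvd 4 * lam"
  proof -
    have "of_int (int (b\<^sup>2 - a\<^sup>2)) * (Y * cnj Y) = of_int (int (4 * lam))"
    proof -
      have "of_real (real (b\<^sup>2 - a\<^sup>2) * (cmod Y)\<^sup>2) = (of_real (real (4 * lam)) :: complex)"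
        using normY b2a2(2) by simp
      then show ?thesis by (simp only: of_real_mult complex_norm_square of_real_of_nat_eq of_int_of_nat_eq)
    qed
    moreover have "Y * cnj Y \<in> cyc_int" using Y_int by simp
    moreover have "int (b\<^sup>2 - a\<^sup>2) \<noteq> 0" using b2a2(1) by linarith
    ultimately have "int (b\<^sup>2 - a\<^sup>2) dvd int (4 * lam)"
      using cyc_int_rat_is_int by blast
    then show ?thesis by (simp only: of_nat_dvd_iff)
  qed
  then have N: "N * (b\<^sup>2 - a\<^sup>2) = 4 * lam" by (simp add: N_def quot_number_def)
  have YN: "(cmod Y)\<^sup>2 = real N"
  proof -
    have "real (b\<^sup>2 - a\<^sup>2) * (cmod Y)\<^sup>2 = real (b\<^sup>2 - a\<^sup>2) * real N"
      using normY b2a2(2) arg_cong[OF N, of real] by (simp add: mult.commute)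
    moreover have "real (b\<^sup>2 - a\<^sup>2) \<noteq> 0" using b2a2(1) by linarith
    ultimately show ?thesis using mult_left_cancel by blast
  qed
  have YcY: "Y * cnj Y = of_nat N"
    using complex_norm_square[of Y] YN by simp
  have "subfield_of_degree K (cyclotomic_field n) f" using assms(16) by (simp add: n_def)
  from exists_fixing_residues[OF this]
  obtain S where S: "S \<subseteq> {..<n}" "card S = f" "\<forall>s\<in>S. \<not> p dvd s"
    "\<forall>s\<in>S. \<forall>t\<in>S. s * t mod n \<in> S"
    "\<forall>x\<in>cyc_rat. (\<forall>s\<in>S. galois s x = x) \<longrightarrow> x \<in> K"
    by (elim exE conjE) (rule that)
  have "\<exists>j. \<forall>s\<in>S. galois s (Y * z ^ j) = Y * z ^ j"
  proof (cases "N > 1")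
    case True
    show ?thesis
    proof (rule exists_z_power_twist_fixed_by_subgroup[OF Y_int YcY True _ S(1)])
      show "\<And>s. s \<in> S \<Longrightarrow> \<not> p dvd s" "\<And>s t. s \<in> S \<Longrightarrow> t \<in> S \<Longrightarrow> s * t mod n \<in> S"
        using S(3,4) by simp_all
      show "\<not> p dvd N" using assms(14) by (simp add: N_def)
      fix q assume "q \<in> prime_factors N"
      then show "card S dvd Pocklington.ord p q" unfolding S(2) assms(15) N_def[symmetric] by (simp add: Gcd_dvd)
    qed
  next
    case False
    \<comment> \<open>The gcd over no primes is 0, so \<open>S\<close> is empty and any
      \<open>j\<close> is a valid twist.\<close>
    then have "prime_factors N = {}" by (cases "N = 0") (auto simp: le_Suc_eq not_less)
    then have "card S = 0" using S(2) assms(15) by (simp add: N_def)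
    then have "S = {}" using S(1) finite_subset by fastforce
    then show ?thesis by simp
  qed
  then obtain j where j: "\<forall>s\<in>S. galois s (Y * z ^ j) = Y * z ^ j" by blast
  have YK: "Y * z ^ j \<in> K" using Y_int j S(5) by (simp add: cyc_int_subset_cyc_rat)
  have sf: "subfield K complex_field" using assms(16) by (simp add: subfield_of_degree_def)
  note K = subfield_complexD[OF sf]
  have "char_sum \<chi> (D i) * z powi int j \<in> K \<and>
      (char_sum \<chi> (D i) * cnj (char_sum \<chi> (D i))
         = of_real ((real a + real b) * real lam / (real b - real a)) \<or>
       char_sum \<chi> (D i) * cnj (char_sum \<chi> (D i))
         = of_real ((real b - real a) * real lam / (real b + real a)))" if i: "i \<in> {1..m}" for i
  proof -
    define x where "x = char_sum \<chi> (D i)"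
    obtain c where c: "2 * x = of_int c * Y" "c = int a + int b \<or> c = int a - int b"
      using x_eq[OF i] unfolding x_def by blast
    \<comment> \<open>Every block value is a rational multiple of \<open>Y\<close>, so one twist
      serves all blocks.\<close>
    have "x = inverse (of_int 2) * of_int c * Y" using c(1) by (simp add: field_simps)
    then have "x * z powi int j = inverse (of_int 2) * of_int c * (Y * z ^ j)" by simp
    then have in_K: "x * z powi int j \<in> K" using YK by (simp only: K)
    have "4 * (cmod x)\<^sup>2 = (cmod (2 * x))\<^sup>2" by (simp add: norm_mult power_mult_distrib)
    also have "\<dots> = (real_of_int c)\<^sup>2 * real N" by (simp add: c(1) norm_mult power_mult_distrib YN)
    finally have x4: "4 * (cmod x)\<^sup>2 = (real_of_int c)\<^sup>2 * real N" .
    \<comment> \<open>Multiplying \<open>x4\<close> by \<open>b - a\<close> or by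
      \<open>b + a\<close>, according to the sign in \<open>c\<close>, turns \<open>N\<close> into
      \<open>lam\<close> by this identity.\<close>
    have Nl: "real N * ((real b - real a) * (real b + real a)) = 4 * real lam"
      using normY YN by (simp add: power2_eq_square algebra_simps)
    have pos: "real b - real a > 0" "real b + real a > 0" using ab by simp_all
    from c(2) have "(cmod x)\<^sup>2 = (real a + real b) * real lam / (real b - real a) \<or>
        (cmod x)\<^sup>2 = (real b - real a) * real lam / (real b + real a)"
    proof
      assume "c = int a + int b"
      then have "4 * (cmod x)\<^sup>2 = (real a + real b)\<^sup>2 * real N" using x4 by simp
      then have "4 * (cmod x)\<^sup>2 * (real b - real a) = (real a + real b)\<^sup>2 * real N * (real b - real a)"
        by (simp only:)
      then have "4 * ((cmod x)\<^sup>2 * (real b - real a))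
          = (real a + real b) * (real N * ((real b - real a) * (real b + real a)))"
        by (simp add: power2_eq_square algebra_simps)
      then have "(cmod x)\<^sup>2 * (real b - real a) = (real a + real b) * real lam" by (simp add: Nl)
      then show ?thesis using pos by (simp add: field_simps)
    next
      assume "c = int a - int b"
      then have "4 * (cmod x)\<^sup>2 = (real a - real b)\<^sup>2 * real N" using x4 by simp
      then have "4 * (cmod x)\<^sup>2 * (real b + real a) = (real a - real b)\<^sup>2 * real N * (real b + real a)"
        by (simp only:)
      then have "4 * ((cmod x)\<^sup>2 * (real b + real a))
          = (real b - real a) * (real N * ((real b - real a) * (real b + real a)))"
        by (simp add: power2_eq_square algebra_simps)
      then have "(cmod x)\<^sup>2 * (real b + real a) = (real b - real a) * real lam" by (simp add: Nl)
      then show ?thesis using pos by (simp add: field_simps)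
    qed
    then show ?thesis using in_K unfolding x_def[symmetric] complex_norm_square[symmetric]
      by (metis of_real_eq_iff)
  qed
  then show ?thesis unfolding zn by blast
qed

end
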